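(* For every constant $x > 4/\mathrm{e}$ there exists $\alpha_0 > 0$ such that for all $0 < \alpha < \alpha_0$, \[ c_\mathrm{crit}(\alpha) \ge 2\,\frac{\ln(1/\alpha) + 1}{\alpha} - \frac{x}{\sqrt{\alpha}} \, . \]
   Context: For a constant $c > 0$, let $G(n,p=c/n)$ be the Erdős–Rényi random graph on $n$ vertices with each edge present independently with probability $c/n$. For each $c$ there is a constant $\alpha_\mathrm{crit}(c)$ such that $\lim_{n\to\infty}\Pr[G(n,p=c/n)$ has an independent set of size $\alpha n] = 1$ for $\alpha < \alpha_\mathrm{crit}(c)$ and $=0$ for $\alpha > \alpha_\mathrm{crit}(c)$ (the same threshold holds for the random graph $G(n,m=cn/2)$ with $cn/2$ uniformly random edges). Define $c_\mathrm{crit}(\alpha) = \sup\{c : \alpha_\mathrm{crit}(c) \ge \alpha\}$. *)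

theory Defs
  imports "HOL-Probability.Probability"
begin

definition vertex_pairs :: "nat \<Rightarrow> nat set set" where
  "vertex_pairs n = {e. e \<subseteq> {..<n} \<and> card e = 2}"

(* A graph on the vertex set {..<n} is represented by its edge set, a subset of
   vertex_pairs n. As bernoulli_pmf clamps its parameter to [0,1], gnp n (c / n) is
   also defined for the finitely many n < c; limits in n are unaffected. *)
definition gnp :: "nat \<Rightarrow> real \<Rightarrow> nat set set pmf" where
  "gnp n p =
     map_pmf (\<lambda>present. {e \<in> vertex_pairs n. present e})
       (Pi_pmf (vertex_pairs n) False (\<lambda>_. bernoulli_pmf p))"

definition independent_set :: "nat \<Rightarrow> nat set set \<Rightarrow> nat set \<Rightarrow> bool" where
  "independent_set n E S \<longleftrightarrow> S \<subseteq> {..<n} \<and> (\<forall>u\<in>S. \<forall>v\<in>S. {u, v} \<notin> E)"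

(* "Size \<alpha> n" is rounded up to an integer. Subsets of independent sets are
   independent, so this also is the probability of an independent set of size at least
   \<alpha> n. For \<alpha> \<le> 0 the required size is 0 and the probability is 1. *)
definition indep_prob :: "real \<Rightarrow> real \<Rightarrow> nat \<Rightarrow> real" where
  "indep_prob c \<alpha> n =
     measure_pmf.prob (gnp n (c / real n))
       {E. \<exists>S. independent_set n E S \<and> card S = nat \<lceil>\<alpha> * real n\<rceil>}"

definition is_indep_threshold :: "real \<Rightarrow> real \<Rightarrow> bool" where
  "is_indep_threshold c a \<longleftrightarrow>
     (\<forall>\<alpha><a. indep_prob c \<alpha> \<longlonglongrightarrow> 1) \<and> (\<forall>\<alpha>>a. indep_prob c \<alpha> \<longlonglongrightarrow> 0)"

(* At most one a can satisfy is_indep_threshold c a; that one exists for every c > 0 is a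
   theorem of Bayati, Gamarnik and Tetali and is not assumed anywhere here. *)
definition alpha_crit :: "real \<Rightarrow> real" where
  "alpha_crit c = (THE a. is_indep_threshold c a)"

definition c_crit :: "real \<Rightarrow> real" where
  "c_crit \<alpha> = Sup {c. c > 0 \<and> alpha_crit c \<ge> \<alpha>}"

end

theory Submission
  imports Defs "HOL-Real_Asymp.Real_Asymp"
begin

text \<open>
  Edges are interpolated from two disjoint random graphs to one random graph on the union
  (Bayati, Gamarnik, Tetali). An extra edge lowers the independence number exactly when both its
  ends lie in every maximum independent set, and convexity of the square makes the mean independence
  number superadditive up to a constant. So its ratio to \<open>n\<close> converges, and bounded differences
  turn the limit into the threshold \<open>alpha_crit c\<close>; a crude first moment bound then shows that the set
  in the definition of \<open>c_crit\<close> is bounded above.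

  For the lower bound, the second moment method is applied to independent sets of size \<open>\<beta> n\<close> with at
  most one vertex in each block of \<open>k\<close> consecutive vertices (Frieze). Large overlaps are harmless
  exactly up to the loss \<open>4 / (e sqrt \<beta>)\<close> in \<open>c\<close>. Small overlaps cost a factor
  \<open>exp (O (\<beta>^3 ln (1/\<beta>) n))\<close>, so the second moment alone gives only an exponentially small
  probability; but the martingale exposing whole blocks has just \<open>n / k\<close> steps, and with \<open>k\<close> about \<open>\<beta> powr (-1/4)\<close>
  concentration upgrades this to a bound on the mean at a cost that is negligible against
  \<open>1 / sqrt \<beta>\<close>.
\<close>

section \<open>Product measures on edge sets and bounded differences\<close>

text \<open>The constant 4/e: for sets of size \<beta> n the first moment asks for \<beta> c / 2
  \<le> ln (1/\<beta>) + 1, up to lower order. Pairs of sets differing in a fraction w of their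
  vertices add - 2 w ln w - w ln (1/\<beta>) to the exponent per vertex; the maximum, at w = sqrt
  \<beta> / e, is (2/e) sqrt \<beta>. Lowering \<beta> c / 2 by this costs 4 / (e sqrt \<beta>) in
  c. The powers: a shift h of the density costs about 2 h ln (1/\<beta>) / \<beta>^2 in c, so h must
  be of smaller order than \<beta>^(3/2) / ln (1/\<beta>). Exposing single vertices would lose h of
  order \<beta>^(3/2) sqrt (ln (1/\<beta>)), just too much. Blocks of size \<beta>^(-t) improve this
  to \<beta>^((3+t)/2) up to logarithms, enough for every t > 0; but keeping to one vertex per block
  lowers the exponent by about \<beta>^(1-t), negligible against sqrt \<beta> only for t < 1/2.
  Hence t = 1/4, and an excess density \<beta>^(8/5) with exponent between 3/2 and 13/8.\<close>

definition bexp :: "'a set \<Rightarrow> ('a \<Rightarrow> real) \<Rightarrow> ('a set \<Rightarrow> real) \<Rightarrow> real" where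
  "bexp P p f = (\<Sum>E\<in>Pow P. (\<Prod>e\<in>E. p e) * (\<Prod>e\<in>P - E. 1 - p e) * f E)"

lemma bexp_empty [simp]: "bexp {} p f = f {}"
  by (simp add: bexp_def)

lemma bexp_cong:
  assumes "\<And>E. E \<subseteq> P \<Longrightarrow> f E = g E" "\<And>e. e \<in> P \<Longrightarrow> p e = q e"
  shows "bexp P p f = bexp P q g"
  unfolding bexp_def
proof (rule sum.cong[OF refl])
  fix E assume "E \<in> Pow P"
  then have E: "E \<subseteq> P" by simp
  have "(\<Prod>e\<in>E. p e) = (\<Prod>e\<in>E. q e)" "(\<Prod>e\<in>P - E. 1 - p e) = (\<Prod>e\<in>P - E. 1 - q e)"
    using assms(2) E by (auto intro!: prod.cong)
  then show "(\<Prod>e\<in>E. p e) * (\<Prod>e\<in>P - E. 1 - p e) * f E = (\<Prod>e\<in>E. q e) * (\<Prod>e\<in>P - E. 1 - q e) * g E"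
    using assms(1)[OF E] by simp
qed

lemma bexp_insert:
  assumes "finite P" "e \<notin> P"
  shows "bexp (insert e P) p f = p e * bexp P p (\<lambda>E. f (insert e E)) + (1 - p e) * bexp P p f"
proof -
  let ?w = "\<lambda>Q E. (\<Prod>e\<in>E. p e) * (\<Prod>e\<in>Q - E. 1 - p e)"
  have inj: "inj_on (insert e) (Pow P)"
    using assms(2) by (auto simp: inj_on_def)
  have "bexp (insert e P) p f = (\<Sum>E\<in>Pow P. ?w (insert e P) E * f E)
      + (\<Sum>E\<in>insert e ` Pow P. ?w (insert e P) E * f E)"
    unfolding bexp_def Pow_insert
    by (rule sum.union_disjoint) (use assms in auto)
  also have "(\<Sum>E\<in>insert e ` Pow P. ?w (insert e P) E * f E)
      = (\<Sum>E\<in>Pow P. ?w (insert e P) (insert e E) * f (insert e E))"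
    by (subst sum.reindex[OF inj]) simp
  also have "\<dots> = (\<Sum>E\<in>Pow P. p e * (?w P E * f (insert e E)))"
  proof (rule sum.cong[OF refl])
    fix E assume "E \<in> Pow P"
    then have "finite E" "e \<notin> E" "insert e P - insert e E = P - E"
      using assms by (auto intro: finite_subset)
    then show "?w (insert e P) (insert e E) * f (insert e E) = p e * (?w P E * f (insert e E))"
      by simp
  qed
  also have "(\<Sum>E\<in>Pow P. ?w (insert e P) E * f E) = (\<Sum>E\<in>Pow P. (1 - p e) * (?w P E * f E))"
  proof (rule sum.cong[OF refl])
    fix E assume "E \<in> Pow P"
    then have "insert e P - E = insert e (P - E)" "e \<notin> P - E" "finite (P - E)"
      using assms by auto
    then show "?w (insert e P) E * f E = (1 - p e) * (?w P E * f E)"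
      by simp
  qed
  finally show ?thesis
    unfolding bexp_def by (simp add: sum_distrib_left)
qed

lemma bexp_add: "bexp P p (\<lambda>E. f E + g E) = bexp P p f + bexp P p g"
  unfolding bexp_def by (simp add: ring_distribs sum.distrib)

lemma bexp_diff: "bexp P p (\<lambda>E. f E - g E) = bexp P p f - bexp P p g"
  unfolding bexp_def by (simp add: algebra_simps sum_subtractf)

lemma bexp_cmult: "bexp P p (\<lambda>E. r * f E) = r * bexp P p f"
  unfolding bexp_def by (simp add: sum_distrib_left mult_ac)

lemma bexp_uminus: "bexp P p (\<lambda>E. - f E) = - bexp P p f"
  unfolding bexp_def by (simp add: sum_negf)

lemma bexp_sum: "bexp P p (\<lambda>E. \<Sum>i\<in>I. f i E) = (\<Sum>i\<in>I. bexp P p (f i))"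
  unfolding bexp_def by (subst sum.swap) (simp add: sum_distrib_left)

lemma bexp_const [simp]: "finite P \<Longrightarrow> bexp P p (\<lambda>_. r) = r"
  by (induction P rule: finite_induct) (simp_all add: bexp_insert algebra_simps)

lemma bexp_mono:
  assumes "\<And>e. e \<in> P \<Longrightarrow> 0 \<le> p e \<and> p e \<le> 1" "\<And>E. E \<subseteq> P \<Longrightarrow> f E \<le> g E"
  shows "bexp P p f \<le> bexp P p g"
  unfolding bexp_def
  by (intro sum_mono mult_left_mono mult_nonneg_nonneg prod_nonneg) (use assms in auto)

lemma bexp_union:
  assumes "finite A" "finite B" "A \<inter> B = {}"
  shows "bexp (A \<union> B) p f = bexp A p (\<lambda>E. bexp B p (\<lambda>F. f (E \<union> F)))"
  using assms(1,3)
proof (induction A arbitrary: f rule: finite_induct)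
  case (insert e A)
  then show ?case
    using assms(2) by (simp add: bexp_insert)
qed simp

lemma bexp_zero:
  assumes "finite P" "\<And>e. e \<in> P \<Longrightarrow> p e = 0"
  shows "bexp P p f = f {}"
  using assms by (induction P arbitrary: f rule: finite_induct) (simp_all add: bexp_insert)

lemma bexp_reindex:
  assumes "finite P" "inj_on h P"
  shows "bexp (h ` P) p f = bexp P (\<lambda>e. p (h e)) (\<lambda>E. f (h ` E))"
  using assms
proof (induction P arbitrary: f rule: finite_induct)
  case (insert e P)
  then show ?case
    by (simp add: bexp_insert)
qed simp

lemma bexp_avoid:
  assumes "finite P" "Q \<subseteq> P"
  shows "bexp P p (\<lambda>E. of_bool (E \<inter> Q = {})) = (\<Prod>e\<in>Q. 1 - p e)"
  using assms
proof (induction P arbitrary: Q rule: finite_induct)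
  case (insert e P)
  show ?case
  proof (cases "e \<in> Q")
    case True
    let ?Q = "Q - {e}"
    have "finite Q" using insert by (meson finite.insertI finite_subset)
    have "bexp P p (\<lambda>E. of_bool (E \<inter> Q = {})) = bexp P p (\<lambda>E. of_bool (E \<inter> ?Q = {}))"
      by (rule bexp_cong) (use insert in auto)
    also have "\<dots> = (\<Prod>e\<in>?Q. 1 - p e)"
      using insert by (intro insert.IH) auto
    finally show ?thesis
      using True insert \<open>finite Q\<close> by (simp add: bexp_insert prod.remove)
  next
    case False
    then have "Q \<subseteq> P" using insert by auto
    then show ?thesis
      using insert.IH[of Q] insert.hyps False by (simp add: bexp_insert algebra_simps)
  qed
qed simp

lemma bexp_bounds:
  assumes "finite P" "\<And>e. e \<in> P \<Longrightarrow> 0 \<le> p e \<and> p e \<le> 1" "\<And>E. E \<subseteq> P \<Longrightarrow> l \<le> f E \<and> f E \<le> u"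
  shows "l \<le> bexp P p f" "bexp P p f \<le> u"
proof -
  have "bexp P p (\<lambda>_. l) \<le> bexp P p f" by (rule bexp_mono) (use assms in auto)
  then show "l \<le> bexp P p f" using assms by simp
  have "bexp P p f \<le> bexp P p (\<lambda>_. u)" by (rule bexp_mono) (use assms in auto)
  then show "bexp P p f \<le> u" using assms by simp
qed

section \<open>Random graphs as product measures\<close>

lemma finite_vertex_pairs [simp]: "finite (vertex_pairs n)"
  by (rule finite_subset[of _ "Pow {..<n}"]) (auto simp: vertex_pairs_def)

text \<open>The bridge from \<open>gnp\<close> to finite sums. With \<open>bexp\<close> every edge
  may have its own probability, as interpolation requires, and expectations are polynomials in these
  probabilities, hence differentiable.\<close>

lemma prob_gnp:
  assumes "0 \<le> p" "p \<le> 1"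
  shows "measure_pmf.prob (gnp n p) {E. Q E} = bexp (vertex_pairs n) (\<lambda>_. p) (\<lambda>E. of_bool (Q E))"
proof -
  let ?P = "vertex_pairs n"
  let ?D = "Pi_pmf ?P False (\<lambda>_. bernoulli_pmf p)"
  let ?h = "\<lambda>present. {e \<in> ?P. present e}"
  have set: "set_pmf ?D \<subseteq> {f. \<forall>x. x \<notin> ?P \<longrightarrow> f x = False}"
    by (rule set_Pi_pmf_subset) simp
  have pm: "pmf (gnp n p) E = (\<Prod>e\<in>E. p) * (\<Prod>e\<in>?P - E. 1 - p)" if "E \<subseteq> ?P" for E
  proof -
    \<comment> \<open>The default \<open>False\<close> outside \<open>?P\<close> matters: without it
      the preimage holds every function that agrees with membership in \<open>E\<close> on
      \<open>?P\<close>.\<close>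
    have pre: "?h -` {E} \<inter> {f. \<forall>x. x \<notin> ?P \<longrightarrow> f x = False} = {\<lambda>e. e \<in> E}"
      using that by (auto simp: fun_eq_iff)
    have "pmf (gnp n p) E = measure_pmf.prob ?D (?h -` {E})"
      unfolding gnp_def by (simp add: pmf_map)
    also have "\<dots> = measure_pmf.prob ?D (?h -` {E} \<inter> {f. \<forall>x. x \<notin> ?P \<longrightarrow> f x = False})"
      by (rule measure_prob_cong_0) (use set in \<open>auto simp: pmf_eq_0_set_pmf\<close>)
    also have "\<dots> = pmf ?D (\<lambda>e. e \<in> E)"
      unfolding pre by (simp add: measure_pmf_single)
    also have "\<dots> = (\<Prod>e\<in>?P. pmf (bernoulli_pmf p) (e \<in> E))"
      using that by (subst pmf_Pi) auto
    also have "\<dots> = (\<Prod>e\<in>E \<union> (?P - E). pmf (bernoulli_pmf p) (e \<in> E))"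
      using that by (intro prod.cong) auto
    also have "\<dots> = (\<Prod>e\<in>E. pmf (bernoulli_pmf p) (e \<in> E)) * (\<Prod>e\<in>?P - E. pmf (bernoulli_pmf p) (e \<in> E))"
      by (rule prod.union_disjoint) (use that in \<open>auto intro: finite_subset[OF _ finite_vertex_pairs]\<close>)
    also have "\<dots> = (\<Prod>e\<in>E. p) * (\<Prod>e\<in>?P - E. 1 - p)"
      using assms by (intro arg_cong2[where f = "(*)"] prod.cong) auto
    finally show ?thesis .
  qed
  have sub: "set_pmf (gnp n p) \<subseteq> Pow ?P"
    unfolding gnp_def by auto
  have "measure_pmf.prob (gnp n p) {E. Q E} = measure_pmf.prob (gnp n p) {E\<in>Pow ?P. Q E}"
    by (rule measure_prob_cong_0) (use sub in \<open>auto simp: pmf_eq_0_set_pmf\<close>)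
  also have "\<dots> = (\<Sum>E\<in>{E\<in>Pow ?P. Q E}. pmf (gnp n p) E)"
    by (rule measure_measure_pmf_finite) simp
  also have "\<dots> = (\<Sum>E\<in>Pow ?P. if Q E then pmf (gnp n p) E else 0)"
    by (rule sum.inter_filter) simp
  also have "\<dots> = bexp ?P (\<lambda>_. p) (\<lambda>E. of_bool (Q E))"
    unfolding bexp_def by (rule sum.cong) (auto simp: pm)
  finally show ?thesis .
qed

section \<open>Exponential moments and tail bounds\<close>

lemma exp_le_quadratic:
  fixes y :: real
  assumes "\<bar>y\<bar> \<le> 1"
  shows "exp y \<le> 1 + y + y\<^sup>2"
proof (cases "y \<ge> 0")
  case True
  then show ?thesis using exp_bound[of y] assms by simp
next
  case False
  define z where "z = - y"
  have z: "0 < z" "z \<le> 1" using False assms by (auto simp: z_def)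
  have "1 + z + z\<^sup>2 / 2 \<le> exp z"
    using exp_lower_Taylor_quadratic[of z] z by simp
  moreover have "1 \<le> (1 - z + z\<^sup>2) * (1 + z + z\<^sup>2 / 2)"
  proof -
    have "(1 - z + z\<^sup>2) * (1 + z + z\<^sup>2 / 2) - 1 = z^2/2 + z^3/2 + z^4/2"
      by (simp add: field_simps power2_eq_square power3_eq_cube power4_eq_xxxx)
    also have "\<dots> \<ge> 0" using z by simp
    finally show ?thesis by simp
  qed
  moreover have "0 < 1 - z + z\<^sup>2" using z by (simp add: add_nonneg_pos)
  ultimately have "1 \<le> (1 - z + z\<^sup>2) * exp z"
    by (smt (verit) mult_left_mono)
  then have "exp (- z) \<le> 1 - z + z\<^sup>2"
    by (simp add: exp_minus field_simps)
  then show ?thesis by (simp add: z_def)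
qed

text \<open>A weak form of Hoeffding's lemma: in the quadratic bound for exp the linear term has
  mean zero and the square is at most \<open>r\<^sup>2\<close>. Only the constant in the exponent
  suffers. The restriction to small \<open>r\<close> is the origin of
  \<open>t \<le> 2 * real N\<close> in the tail bounds.\<close>

lemma bexp_exp_centered:
  assumes "finite P" "\<And>e. e \<in> P \<Longrightarrow> 0 \<le> p e \<and> p e \<le> 1" "\<bar>r\<bar> \<le> 1"
    "\<And>E E'. E \<subseteq> P \<Longrightarrow> E' \<subseteq> P \<Longrightarrow> f E - f E' \<le> 1"
  shows "bexp P p (\<lambda>E. exp (r * (f E - bexp P p f))) \<le> exp (r\<^sup>2)"
proof -
  let ?m = "bexp P p f"
  have dev: "\<bar>f E - ?m\<bar> \<le> 1" if "E \<subseteq> P" for E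
  proof -
    have "f E - 1 \<le> ?m" "?m \<le> f E + 1"
      using bexp_bounds[where l = "f E - 1" and u = "f E + 1" and P = P and f = f and p = p]
        assms(1,2) assms(4)[OF that] assms(4)[OF _ that] by (smt (verit))+
    then show ?thesis by linarith
  qed
  have "bexp P p (\<lambda>E. exp (r * (f E - ?m))) \<le> bexp P p (\<lambda>E. 1 + r * (f E - ?m) + r\<^sup>2)"
  proof (rule bexp_mono)
    fix E assume "E \<subseteq> P"
    then have d: "\<bar>f E - ?m\<bar> \<le> 1" by (rule dev)
    have "\<bar>r * (f E - ?m)\<bar> \<le> 1"
      using mult_mono[OF assms(3) d] by (simp add: abs_mult)
    then have "exp (r * (f E - ?m)) \<le> 1 + r * (f E - ?m) + (r * (f E - ?m))\<^sup>2"
      by (rule exp_le_quadratic)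
    moreover have "(r * (f E - ?m))\<^sup>2 \<le> r\<^sup>2"
      using mult_left_mono[of "(f E - ?m)\<^sup>2" 1 "r\<^sup>2"] d by (simp add: power_mult_distrib abs_square_le_1)
    ultimately show "exp (r * (f E - ?m)) \<le> 1 + r * (f E - ?m) + r\<^sup>2" by simp
  qed (use assms in auto)
  also have "\<dots> = 1 + r\<^sup>2"
    using assms(1) by (simp add: bexp_add bexp_cmult bexp_diff)
  also have "\<dots> \<le> exp (r\<^sup>2)" by simp
  finally show ?thesis .
qed

text \<open>The map \<open>g\<close> sorts the coordinates into groups, and a whole group may change
  at once; the tail bounds then depend on the number of groups and not on the number of coordinates.
  One-sidedness is harmless because \<open>E\<close> and \<open>E'\<close> may be exchanged.\<close>

definition bounded_differences :: "'a set \<Rightarrow> ('a \<Rightarrow> nat) \<Rightarrow> ('a set \<Rightarrow> real) \<Rightarrow> bool" where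
  "bounded_differences P g f \<longleftrightarrow>
     (\<forall>E E' j. E \<subseteq> P \<longrightarrow> E' \<subseteq> P \<longrightarrow> (\<forall>e. g e \<noteq> j \<longrightarrow> (e \<in> E \<longleftrightarrow> e \<in> E')) \<longrightarrow> f E - f E' \<le> 1)"

lemma bounded_differencesI:
  assumes "\<And>E E' j. E \<subseteq> P \<Longrightarrow> E' \<subseteq> P \<Longrightarrow> (\<And>e. g e \<noteq> j \<Longrightarrow> e \<in> E \<longleftrightarrow> e \<in> E') \<Longrightarrow> f E - f E' \<le> 1"
  shows "bounded_differences P g f"
  using assms unfolding bounded_differences_def by blast

lemma bounded_differencesD:
  assumes "bounded_differences P g f" "E \<subseteq> P" "E' \<subseteq> P"
    "\<And>e. g e \<noteq> j \<Longrightarrow> e \<in> E \<longleftrightarrow> e \<in> E'"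
  shows "f E - f E' \<le> 1"
  using assms unfolding bounded_differences_def by blast

text \<open>The Azuma argument without martingales: average over the last group \<open>B\<close>
  with the others fixed, which costs a factor \<open>exp (r\<^sup>2)\<close>, and continue with the
  conditional mean \<open>F\<close>. Averaging preserves bounded differences, so the induction
  applies to \<open>F\<close>.\<close>

lemma bexp_exp_bounded_differences:
  assumes "finite P" "\<And>e. e \<in> P \<Longrightarrow> 0 \<le> p e \<and> p e \<le> 1" "\<bar>r\<bar> \<le> 1"
    "\<And>e. e \<in> P \<Longrightarrow> g e < (N::nat)"
    "bounded_differences P g f"
  shows "bexp P p (\<lambda>E. exp (r * (f E - bexp P p f))) \<le> exp (real N * r\<^sup>2)"
  using assms
proof (induction N arbitrary: P f)
  case 0
  then have "P = {}" by auto
  then show ?case by simp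
next
  case (Suc N)
  define A B where "A = {e\<in>P. g e < N}" and "B = {e\<in>P. g e = N}"
  have gA: "g e < N" if "e \<in> A" for e using that by (simp add: A_def)
  have gB: "g e = N" if "e \<in> B" for e using that by (simp add: B_def)
  have P: "P = A \<union> B" "A \<inter> B = {}" "finite A" "finite B"
    using Suc.prems by (auto simp: A_def B_def less_Suc_eq)
  define F where "F = (\<lambda>E. bexp B p (\<lambda>H. f (E \<union> H)))"
  have m: "bexp P p f = bexp A p F"
    unfolding P(1) F_def by (rule bexp_union) (use P in auto)
  have p01: "\<And>e. e \<in> A \<Longrightarrow> 0 \<le> p e \<and> p e \<le> 1" "\<And>e. e \<in> B \<Longrightarrow> 0 \<le> p e \<and> p e \<le> 1"
    using Suc.prems(2) P(1) by auto
  have "bexp P p (\<lambda>E. exp (r * (f E - bexp P p f)))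
      = bexp A p (\<lambda>E. bexp B p (\<lambda>H. exp (r * (f (E \<union> H) - bexp A p F))))"
    unfolding m unfolding P(1) by (rule bexp_union) (use P in auto)
  also have "\<dots> \<le> bexp A p (\<lambda>E. exp (r\<^sup>2) * exp (r * (F E - bexp A p F)))"
  proof (rule bexp_mono)
    fix E assume E: "E \<subseteq> A"
    have "bexp B p (\<lambda>H. exp (r * (f (E \<union> H) - bexp A p F)))
       = bexp B p (\<lambda>H. exp (r * (F E - bexp A p F)) * exp (r * (f (E \<union> H) - F E)))"
      by (rule bexp_cong) (simp_all add: exp_add[symmetric] algebra_simps)
    also have "\<dots> = exp (r * (F E - bexp A p F)) * bexp B p (\<lambda>H. exp (r * (f (E \<union> H) - F E)))"
      by (rule bexp_cmult)
    also have "bexp B p (\<lambda>H. exp (r * (f (E \<union> H) - F E))) \<le> exp (r\<^sup>2)"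
      unfolding F_def
    proof (rule bexp_exp_centered)
      fix H H' assume "H \<subseteq> B" "H' \<subseteq> B"
      then show "f (E \<union> H) - f (E \<union> H') \<le> 1"
        using E P by (intro bounded_differencesD[OF Suc.prems(5), where j = N]) (auto dest: gB)
    qed (use P p01 Suc.prems(3) in auto)
    finally show "bexp B p (\<lambda>H. exp (r * (f (E \<union> H) - bexp A p F))) \<le> exp (r\<^sup>2) * exp (r * (F E - bexp A p F))"
      by (simp add: mult.commute)
  qed (use p01 in auto)
  also have "\<dots> = exp (r\<^sup>2) * bexp A p (\<lambda>E. exp (r * (F E - bexp A p F)))"
    by (rule bexp_cmult)
  also have "bexp A p (\<lambda>E. exp (r * (F E - bexp A p F))) \<le> exp (real N * r\<^sup>2)"
  proof (rule Suc.IH[OF _ _ _ _ bounded_differencesI])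
    fix E E' j assume E: "E \<subseteq> A" "E' \<subseteq> A" "\<And>e. g e \<noteq> j \<Longrightarrow> e \<in> E \<longleftrightarrow> e \<in> E'"
    have "F E - F E' = bexp B p (\<lambda>H. f (E \<union> H) - f (E' \<union> H))"
      by (simp add: F_def bexp_diff)
    also have "\<dots> \<le> bexp B p (\<lambda>_. 1)"
    proof (rule bexp_mono)
      fix H assume "H \<subseteq> B"
      then show "f (E \<union> H) - f (E' \<union> H) \<le> 1"
        using E P by (intro bounded_differencesD[OF Suc.prems(5), where j = j]) auto
    qed (use p01 in auto)
    finally show "F E - F E' \<le> 1" using P by simp
  qed (use P p01 Suc.prems(3) gA in auto)
  also have "exp (r\<^sup>2) * exp (real N * r\<^sup>2) = exp (real (Suc N) * r\<^sup>2)"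
    by (simp add: exp_add[symmetric] algebra_simps)
  finally show ?case by simp
qed

lemma bounded_differences_tail:
  assumes "finite P" "\<And>e. e \<in> P \<Longrightarrow> 0 \<le> p e \<and> p e \<le> 1"
    "\<And>e. e \<in> P \<Longrightarrow> g e < (N::nat)"
    "bounded_differences P g f"
    and t: "0 \<le> t" "t \<le> 2 * real N" and "N > 0"
  shows "bexp P p (\<lambda>E. of_bool (f E \<ge> bexp P p f + t)) \<le> exp (- (t\<^sup>2 / (4 * real N)))"
proof -
  \<comment> \<open>This minimises \<open>- r * t + real N * r\<^sup>2\<close>.\<close>
  define r where "r = t / (2 * real N)"
  let ?m = "bexp P p f"
  have r: "0 \<le> r" "r \<le> 1" using t assms(7) by (auto simp: r_def)
  have "bexp P p (\<lambda>E. of_bool (f E \<ge> ?m + t)) \<le> bexp P p (\<lambda>E. exp (- r * t) * exp (r * (f E - ?m)))"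
  proof (rule bexp_mono)
    fix E
    have "1 \<le> exp (- r * t + r * (f E - ?m))" if "f E \<ge> ?m + t"
    proof -
      have "0 \<le> r * (f E - ?m - t)" using r that by simp
      then show ?thesis by (simp add: algebra_simps)
    qed
    then show "of_bool (f E \<ge> ?m + t) \<le> exp (- r * t) * exp (r * (f E - ?m))"
      by (auto simp: exp_add[symmetric])
  qed (use assms in auto)
  also have "\<dots> = exp (- r * t) * bexp P p (\<lambda>E. exp (r * (f E - ?m)))"
    by (rule bexp_cmult)
  also have "\<dots> \<le> exp (- r * t) * exp (real N * r\<^sup>2)"
    by (intro mult_left_mono bexp_exp_bounded_differences[where g = g]) (use assms r in auto)
  also have "\<dots> = exp (- (t\<^sup>2 / (4 * real N)))"
    unfolding exp_add[symmetric] using assms(7) by (simp add: r_def field_simps power2_eq_square)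
  finally show ?thesis .
qed

lemma bounded_differences_lower_tail:
  assumes "finite P" "\<And>e. e \<in> P \<Longrightarrow> 0 \<le> p e \<and> p e \<le> 1"
    "\<And>e. e \<in> P \<Longrightarrow> g e < (N::nat)"
    "bounded_differences P g f"
    and t: "0 \<le> t" "t \<le> 2 * real N" and "N > 0"
  shows "bexp P p (\<lambda>E. of_bool (f E \<le> bexp P p f - t)) \<le> exp (- (t\<^sup>2 / (4 * real N)))"
proof -
  have neg: "bexp P p (\<lambda>E. - f E) = - bexp P p f"
    using bexp_cmult[of P p "-1" f] by simp
  have "bexp P p (\<lambda>E. of_bool (- f E \<ge> bexp P p (\<lambda>E. - f E) + t)) \<le> exp (- (t\<^sup>2 / (4 * real N)))"
  proof (rule bounded_differences_tail[OF _ _ _ bounded_differencesI[where g = g]])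
    fix E E' j assume "E \<subseteq> P" "E' \<subseteq> P" "\<And>e. g e \<noteq> j \<Longrightarrow> e \<in> E \<longleftrightarrow> e \<in> E'"
    then show "- f E - - f E' \<le> 1"
      using bounded_differencesD[OF assms(4), of E' E j] by auto
  qed (use assms in auto)
  moreover have "(- f E \<ge> bexp P p (\<lambda>E. - f E) + t) = (f E \<le> bexp P p f - t)" for E
    unfolding neg by linarith
  ultimately show ?thesis by simp
qed

section \<open>Independence numbers\<close>

definition indep :: "'a set set \<Rightarrow> 'a set \<Rightarrow> bool" where
  "indep E S \<longleftrightarrow> (\<forall>u\<in>S. \<forall>v\<in>S. {u, v} \<notin> E)"

definition pairs :: "'a set \<Rightarrow> 'a set set" where
  "pairs V = {e. e \<subseteq> V \<and> card e = 2}"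

text \<open>The label \<open>b\<close> may be used at most once: \<open>b = id\<close> gives ordinary independent sets,
  \<open>b v = v div k\<close> those with at most one vertex per block.\<close>

definition indep_sets :: "('a \<Rightarrow> 'b) \<Rightarrow> 'a set \<Rightarrow> 'a set set \<Rightarrow> 'a set set" where
  "indep_sets b V E = {S. S \<subseteq> V \<and> inj_on b S \<and> indep E S}"

definition alpha :: "('a \<Rightarrow> 'b) \<Rightarrow> 'a set \<Rightarrow> 'a set set \<Rightarrow> nat" where
  "alpha b V E = Max (card ` indep_sets b V E)"

lemma vertex_pairs_eq: "vertex_pairs n = pairs {..<n}"
  by (simp add: vertex_pairs_def pairs_def)

lemma finite_pairs [simp]: "finite V \<Longrightarrow> finite (pairs V)"
  by (rule finite_subset[of _ "Pow V"]) (auto simp: pairs_def)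

lemma card_pairs: "finite V \<Longrightarrow> card (pairs V) = card V choose 2"
  by (simp add: pairs_def n_subsets)

text \<open>Taking u = v, \<open>indep\<close> forbids loops as well; a subset of
  \<open>pairs V\<close> has none.\<close>

lemma indep_iff: "E \<subseteq> pairs V \<Longrightarrow> indep E S \<longleftrightarrow> E \<inter> pairs S = {}"
  unfolding indep_def pairs_def by (auto simp: card_2_iff)

lemma indep_mono: "indep E S \<Longrightarrow> E' \<subseteq> E \<Longrightarrow> T \<subseteq> S \<Longrightarrow> indep E' T"
  unfolding indep_def by blast

lemma finite_indep_sets: "finite V \<Longrightarrow> finite (indep_sets b V E)"
  by (rule finite_subset[of _ "Pow V"]) (auto simp: indep_sets_def)

lemma card_le_alpha:
  assumes "finite V" "S \<in> indep_sets b V E"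
  shows "card S \<le> alpha b V E"
  unfolding alpha_def using assms finite_indep_sets by (intro Max_ge) auto

lemma alpha_attained:
  assumes "finite V"
  obtains S where "S \<in> indep_sets b V E" "card S = alpha b V E"
proof -
  have "{} \<in> indep_sets b V E" by (simp add: indep_sets_def indep_def)
  then have "alpha b V E \<in> card ` indep_sets b V E"
    unfolding alpha_def using assms finite_indep_sets by (intro Max_in) auto
  then show ?thesis using that by auto
qed

lemma alpha_le_card:
  assumes "finite V"
  shows "alpha b V E \<le> card V"
  by (rule alpha_attained[OF assms, of b E]) (metis (mono_tags, lifting) assms card_mono indep_sets_def mem_Collect_eq)

lemma alpha_antimono:
  assumes "finite V" "E \<subseteq> E'"
  shows "alpha b V E' \<le> alpha b V E"
proof -
  obtain S where S: "S \<in> indep_sets b V E'" "card S = alpha b V E'"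
    by (rule alpha_attained[OF assms(1)])
  then have "S \<in> indep_sets b V E"
    using assms(2) by (auto simp: indep_sets_def indep_def)
  with S show ?thesis using card_le_alpha[OF assms(1)] by metis
qed

text \<open>An edge is exposed together with the larger label of its ends, so an edge in group
  \<open>j\<close> has an end labelled \<open>j\<close>. An admissible set has at most one such
  vertex, and deleting it makes the set immune to any change within the group. For block labels this
  gives one step per block instead of one per vertex.\<close>

lemma bounded_differences_alpha:
  assumes "finite V"
  shows "bounded_differences (pairs V) (\<lambda>e. Max (b ` e)) (\<lambda>E. real (alpha b V E))"
proof (rule bounded_differencesI)
  fix E E' j
  assume E: "E \<subseteq> pairs V" "E' \<subseteq> pairs V" and agree: "\<And>e. Max (b ` e) \<noteq> j \<Longrightarrow> e \<in> E \<longleftrightarrow> e \<in> E'"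
  obtain S where S: "S \<in> indep_sets b V E" "card S = alpha b V E"
    by (rule alpha_attained[OF assms])
  have fin: "finite S" using S assms by (auto simp: indep_sets_def intro: finite_subset)
  let ?T = "{v\<in>S. b v \<noteq> j}"
  have inj: "inj_on b S" using S by (simp add: indep_sets_def)
  have "?T \<in> indep_sets b V E'"
    unfolding indep_sets_def indep_def
  proof (intro CollectI conjI ballI)
    fix u v assume uv: "u \<in> ?T" "v \<in> ?T"
    then have "Max (b ` {u, v}) \<noteq> j" by (auto simp: max_def)
    then have "{u, v} \<in> E \<longleftrightarrow> {u, v} \<in> E'" by (rule agree)
    then show "{u, v} \<notin> E'" using uv S by (auto simp: indep_sets_def indep_def)
  qed (use S in \<open>auto simp: indep_sets_def intro: inj_on_subset\<close>)
  then have "card ?T \<le> alpha b V E'" by (rule card_le_alpha[OF assms])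
  moreover have "card S \<le> card ?T + 1"
  proof -
    have "card {v\<in>S. b v = j} \<le> 1"
      using inj by (auto simp: card_le_Suc0_iff_eq fin inj_on_def)
    moreover have "card S = card ?T + card {v\<in>S. b v = j}"
      by (subst card_Un_disjoint[symmetric]) (auto simp: fin intro: arg_cong[where f = card])
    ultimately show ?thesis by simp
  qed
  ultimately show "real (alpha b V E) - real (alpha b V E') \<le> 1"
    using S(2) by simp
qed

text \<open>Russo's formula: the expectation is affine in each single \<open>p e\<close>, with slope
  the mean difference between having and not having the edge \<open>e\<close>; the chain rule adds
  these up.\<close>

lemma bexp_deriv:
  assumes "finite P"
    "\<And>e. e \<in> P \<Longrightarrow> ((\<lambda>t. p t e) has_real_derivative p' e) (at t)"
  shows "((\<lambda>t. bexp P (p t) f) has_real_derivative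
     (\<Sum>e\<in>P. p' e * bexp P (p t) (\<lambda>E. f (insert e E) - f (E - {e})))) (at t)"
  using assms
proof (induction P arbitrary: f rule: finite_induct)
  case empty
  then show ?case by simp
next
  case (insert x P)
  let ?B = "\<lambda>f. bexp P (p t) f"
  let ?D = "\<lambda>f. \<Sum>e\<in>P. p' e * ?B (\<lambda>E. f (insert e E) - f (E - {e}))"
  let ?f1 = "\<lambda>E. f (insert x E)"
  have d: "((\<lambda>t. bexp P (p t) f) has_real_derivative ?D f) (at t)" for f
    using insert by auto
  have dx: "((\<lambda>t. p t x) has_real_derivative p' x) (at t)" using insert by auto
  have 1: "((\<lambda>t. p t x * bexp P (p t) ?f1 + (1 - p t x) * bexp P (p t) f) has_real_derivative
     (p' x * ?B ?f1 + ?D ?f1 * p t x) + ((0 - p' x) * ?B f + ?D f * (1 - p t x))) (at t)"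
    by (intro DERIV_add DERIV_mult DERIV_diff DERIV_const d dx)
  have 2: "bexp (insert x P) (p t) (\<lambda>E. f (insert x E) - f (E - {x})) = ?B ?f1 - ?B f"
  proof -
    have "?B (\<lambda>E. f (insert x (insert x E)) - f (insert x E - {x})) = ?B (\<lambda>E. f (insert x E) - f E)"
      "?B (\<lambda>E. f (insert x E) - f (E - {x})) = ?B (\<lambda>E. f (insert x E) - f E)"
      using insert.hyps(2) by (auto intro!: bexp_cong arg_cong[where f = f])
    then show ?thesis
      unfolding bexp_insert[OF insert.hyps(1,2)] by (simp add: bexp_diff algebra_simps)
  qed
  have 3: "bexp (insert x P) (p t) (\<lambda>E. f (insert e E) - f (E - {e}))
      = p t x * ?B (\<lambda>E. ?f1 (insert e E) - ?f1 (E - {e})) + (1 - p t x) * ?B (\<lambda>E. f (insert e E) - f (E - {e}))"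
    if "e \<in> P" for e
  proof -
    have "insert x E - {e} = insert x (E - {e})" for E
      using that insert.hyps(2) by auto
    then show ?thesis
      unfolding bexp_insert[OF insert.hyps(1,2)] by (simp add: insert_commute)
  qed
  have "(p' x * ?B ?f1 + ?D ?f1 * p t x) + ((0 - p' x) * ?B f + ?D f * (1 - p t x))
     = (\<Sum>e\<in>insert x P. p' e * bexp (insert x P) (p t) (\<lambda>E. f (insert e E) - f (E - {e})))"
    using insert.hyps by (simp add: 2 3 sum_distrib_left sum_distrib_right sum.distrib[symmetric] algebra_simps)
  with 1 show ?case
    unfolding bexp_insert[OF insert.hyps(1,2)] by simp
qed

text \<open>Inserting \<open>e\<close> has an effect only if \<open>e\<close> is absent, an event of
  probability \<open>1 - p e\<close> that is independent of the pivotal difference on the right.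
  This translates Russo's differences into the effect of adding an edge to the random graph
  itself.\<close>

lemma bexp_insert_increment:
  assumes "finite P" "e \<in> P"
  shows "bexp P p (\<lambda>E. f (insert e E) - f E) = (1 - p e) * bexp P p (\<lambda>E. f (insert e E) - f (E - {e}))"
proof -
  define Q where "Q = P - {e}"
  have Q: "P = insert e Q" "finite Q" "e \<notin> Q" using assms by (auto simp: Q_def)
  have "bexp Q p (\<lambda>E. f (insert e E) - f (E - {e})) = bexp Q p (\<lambda>E. f (insert e E) - f E)"
    "bexp Q p (\<lambda>E. f (insert e (insert e E)) - f (insert e E - {e})) = bexp Q p (\<lambda>E. f (insert e E) - f E)"
    using Q(3) by (auto intro!: bexp_cong arg_cong[where f = f])
  then show ?thesis
    unfolding Q(1) bexp_insert[OF Q(2,3)] using Q(2) by (simp add: algebra_simps)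
qed

definition frozen :: "'a set \<Rightarrow> 'a set set \<Rightarrow> 'a set" where
  "frozen V E = {v\<in>V. \<forall>S\<in>indep_sets id V E. card S = alpha id V E \<longrightarrow> v \<in> S}"

text \<open>The new edge spoils exactly the independent sets containing both its ends. A maximum set
  that misses an end survives; if there is none, deleting one end from a maximum set shows that the
  loss is only one.\<close>

lemma alpha_insert_edge:
  assumes "finite V" "E \<subseteq> pairs V" "e \<in> pairs V"
  shows "real (alpha id V (insert e E)) - real (alpha id V E) = - of_bool (e \<subseteq> frozen V E)"
proof -
  obtain u v where e: "e = {u, v}" "u \<noteq> v" "u \<in> V" "v \<in> V"
    using assms(3) by (auto simp: pairs_def card_2_iff)
  have le: "alpha id V (insert e E) \<le> alpha id V E"
    by (rule alpha_antimono) (use assms in auto)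
  have ins: "S \<in> indep_sets id V (insert e E)" if "S \<in> indep_sets id V E" "\<not> e \<subseteq> S" for S
    using that e by (auto simp: indep_sets_def indep_def doubleton_eq_iff)
  show ?thesis
  proof (cases "e \<subseteq> frozen V E")
    case False
    then obtain S where S: "S \<in> indep_sets id V E" "card S = alpha id V E" "\<not> e \<subseteq> S"
      using e by (auto simp: frozen_def)
    then have "alpha id V E \<le> alpha id V (insert e E)"
      using card_le_alpha[OF assms(1) ins] by metis
    then show ?thesis using le False by simp
  next
    case True
    obtain S where S: "S \<in> indep_sets id V E" "card S = alpha id V E"
      by (rule alpha_attained[OF assms(1)])
    have fin: "finite S" using S assms by (auto simp: indep_sets_def intro: finite_subset)
    have "S - {u} \<in> indep_sets id V E"
      using S by (auto simp: indep_sets_def indep_def)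
    then have "card (S - {u}) \<le> alpha id V (insert e E)"
      using e by (intro card_le_alpha[OF assms(1)] ins) auto
    moreover have "card (S - {u}) \<ge> card S - 1" using fin by (simp add: card_Diff_singleton_if)
    ultimately have ge: "alpha id V E - 1 \<le> alpha id V (insert e E)" using S by simp
    obtain T where T: "T \<in> indep_sets id V (insert e E)" "card T = alpha id V (insert e E)"
      by (rule alpha_attained[OF assms(1)])
    have TE: "T \<in> indep_sets id V E" using T(1) by (auto simp: indep_sets_def indep_def)
    have "\<not> e \<subseteq> T" using T(1) e by (auto simp: indep_sets_def indep_def)
    then have "card T \<noteq> alpha id V E" using True TE by (auto simp: frozen_def)
    then have "alpha id V (insert e E) < alpha id V E" using le T by simp
    then show ?thesis using ge True by simp
  qed
qed

lemma alpha_disjoint_union: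
  assumes "finite V" "finite W" "V \<inter> W = {}" "E \<subseteq> pairs V" "F \<subseteq> pairs W"
  shows "alpha id (V \<union> W) (E \<union> F) = alpha id V E + alpha id W F"
proof (rule antisym)
  obtain S where S: "S \<in> indep_sets id (V \<union> W) (E \<union> F)" "card S = alpha id (V \<union> W) (E \<union> F)"
    using assms(1,2) by (rule_tac alpha_attained[of "V \<union> W" id "E \<union> F"]) auto
  have "card (S \<inter> V) \<le> alpha id V E" "card (S \<inter> W) \<le> alpha id W F"
    using S by (auto intro!: card_le_alpha assms simp: indep_sets_def indep_def)
  moreover have "card S = card (S \<inter> V) + card (S \<inter> W)"
  proof -
    have "S = (S \<inter> V) \<union> (S \<inter> W)" using S by (auto simp: indep_sets_def)
    then have "card S = card ((S \<inter> V) \<union> (S \<inter> W))" by simp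
    also have "\<dots> = card (S \<inter> V) + card (S \<inter> W)"
      by (rule card_Un_disjoint) (use assms in auto)
    finally show ?thesis .
  qed
  ultimately show "alpha id (V \<union> W) (E \<union> F) \<le> alpha id V E + alpha id W F"
    using S by simp
next
  obtain S T where S: "S \<in> indep_sets id V E" "card S = alpha id V E"
    and T: "T \<in> indep_sets id W F" "card T = alpha id W F"
    using alpha_attained[OF assms(1)] alpha_attained[OF assms(2)] by metis
  have sub: "S \<subseteq> V" "T \<subseteq> W" using S T by (auto simp: indep_sets_def)
  have EV: "e \<subseteq> V" if "e \<in> E" for e using that assms(4) by (auto simp: pairs_def)
  have FW: "e \<subseteq> W" if "e \<in> F" for e using that assms(5) by (auto simp: pairs_def)
  have "S \<union> T \<in> indep_sets id (V \<union> W) (E \<union> F)"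
    unfolding indep_sets_def indep_def
  proof (intro CollectI conjI ballI)
    fix u v assume "u \<in> S \<union> T" "v \<in> S \<union> T"
    moreover have "{u, v} \<notin> E" if "u \<in> T \<or> v \<in> T"
      using that EV[of "{u, v}"] assms(3) sub by auto
    moreover have "{u, v} \<notin> F" if "u \<in> S \<or> v \<in> S"
      using that FW[of "{u, v}"] assms(3) sub by auto
    ultimately show "{u, v} \<notin> E \<union> F"
      using S(1) T(1) by (auto simp: indep_sets_def indep_def)
  qed (use sub in auto)
  then have "card (S \<union> T) \<le> alpha id (V \<union> W) (E \<union> F)"
    using assms by (intro card_le_alpha) auto
  moreover have "card (S \<union> T) = card S + card T"
    by (rule card_Un_disjoint) (use sub assms in \<open>auto intro: finite_subset\<close>)
  ultimately show "alpha id V E + alpha id W F \<le> alpha id (V \<union> W) (E \<union> F)"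
    using S T by simp
qed

section \<open>Mean independence numbers\<close>

definition mean_alpha :: "nat set \<Rightarrow> real \<Rightarrow> real" where
  "mean_alpha V p = bexp (pairs V) (\<lambda>_. p) (\<lambda>E. real (alpha id V E))"

text \<open>Invariance under relabelling: superadditivity splits off a second vertex set that does
  not start at 0, and it has to be shifted back.\<close>

lemma mean_alpha_image:
  assumes "finite V" "inj_on h V"
  shows "mean_alpha (h ` V) p = mean_alpha V p"
proof -
  have inj: "inj_on ((`) h) (pairs V)"
    using assms(2) by (auto simp: pairs_def inj_on_def inj_on_image_eq_iff[OF assms(2)])
  have im: "pairs (h ` V) = (`) h ` pairs V"
  proof (intro set_eqI iffI)
    fix e assume "e \<in> pairs (h ` V)"
    then obtain d where "d \<subseteq> V" "e = h ` d" "card e = 2"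
      by (auto simp: pairs_def subset_image_iff)
    then show "e \<in> (`) h ` pairs V"
      using assms(2) by (auto simp: pairs_def card_image inj_on_subset)
  next
    fix e assume "e \<in> (`) h ` pairs V"
    then show "e \<in> pairs (h ` V)"
      using assms(2) by (auto simp: pairs_def card_image inj_on_subset)
  qed
  have al: "alpha id (h ` V) ((`) h ` E) = alpha id V E" if "E \<subseteq> pairs V" for E
  proof -
    have edge: "{h u, h v} \<in> (`) h ` E \<longleftrightarrow> {u, v} \<in> E" if "u \<in> V" "v \<in> V" for u v
    proof
      assume "{h u, h v} \<in> (`) h ` E"
      then obtain e where e: "e \<in> E" "h ` {u, v} = h ` e" by auto
      then have "e \<subseteq> V" using \<open>E \<subseteq> pairs V\<close> by (auto simp: pairs_def)
      then have "{u, v} = e" using e(2) that assms(2) by (subst (asm) inj_on_image_eq_iff) auto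
      then show "{u, v} \<in> E" using e by simp
    next
      assume "{u, v} \<in> E"
      then have "h ` {u, v} \<in> (`) h ` E" by blast
      then show "{h u, h v} \<in> (`) h ` E" by simp
    qed
    have ind: "indep ((`) h ` E) (h ` S) \<longleftrightarrow> indep E S" if "S \<subseteq> V" for S
      using that edge unfolding indep_def by (auto simp: subset_iff)
    have "indep_sets id (h ` V) ((`) h ` E) = (`) h ` indep_sets id V E"
    proof (intro set_eqI iffI)
      fix S assume "S \<in> indep_sets id (h ` V) ((`) h ` E)"
      then obtain T where T: "T \<subseteq> V" "S = h ` T" "indep ((`) h ` E) S"
        by (auto simp: indep_sets_def subset_image_iff)
      then show "S \<in> (`) h ` indep_sets id V E"
        using ind by (auto simp: indep_sets_def)
    next
      fix S assume "S \<in> (`) h ` indep_sets id V E"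
      then show "S \<in> indep_sets id (h ` V) ((`) h ` E)"
        using ind by (auto simp: indep_sets_def)
    qed
    then have "card ` indep_sets id (h ` V) ((`) h ` E) = card ` indep_sets id V E"
      unfolding image_image using assms(2)
      by (auto intro!: image_cong simp: image_image indep_sets_def card_image inj_on_subset)
    then show ?thesis by (simp add: alpha_def)
  qed
  show ?thesis
    unfolding mean_alpha_def im
    by (subst bexp_reindex) (use assms inj al in \<open>auto intro!: bexp_cong\<close>)
qed

section \<open>Interpolation and superadditivity\<close>

lemma pairs_union:
  "pairs (V \<union> W) = pairs V \<union> pairs W \<union> (pairs (V \<union> W) - pairs V - pairs W)"
  by (auto simp: pairs_def)

lemma pairs_disjoint: "V \<inter> W = {} \<Longrightarrow> pairs V \<inter> pairs W = {}"
  by (auto simp: pairs_def card_2_iff)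

lemma inverse_one_minus_le:
  fixes q :: real
  assumes "0 \<le> q" "q \<le> 1/2"
  shows "1 / (1 - q) \<le> 1 + 2 * q"
proof -
  have "1 \<le> (1 + 2 * q) * (1 - q)"
    using assms mult_nonneg_nonneg[of q "1 - 2 * q"] by (simp add: algebra_simps)
  then show ?thesis using assms by (simp add: divide_le_eq)
qed

lemma sum_subset_pairs:
  assumes "finite V"
  shows "(\<Sum>e\<in>pairs V. of_bool (e \<subseteq> A)) = real (card (V \<inter> A) choose 2)"
proof -
  have "(\<Sum>e\<in>pairs V. of_bool (e \<subseteq> A)) = (\<Sum>e\<in>pairs V \<inter> {e. e \<subseteq> A}. 1::real)"
    using assms by (simp add: of_bool_def sum.If_cases)
  also have "pairs V \<inter> {e. e \<subseteq> A} = pairs (V \<inter> A)"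
    by (auto simp: pairs_def)
  finally show ?thesis using assms by (simp add: card_pairs)
qed

lemma real_choose_two: "real (n choose 2) = real n * (real n - 1) / 2"
  by (cases n) (simp_all add: choose_two real_of_nat_div algebra_simps)

lemma interpolation_convexity:
  fixes m1 m2 x y :: real
  assumes "m1 > 0" "m2 > 0" "0 \<le> x" "x \<le> m1" "0 \<le> y" "y \<le> m2"
  shows "(x + y) * (x + y - 1) / 2 / (m1 + m2) - x * (x - 1) / 2 / m1 - y * (y - 1) / 2 / m2 \<le> 1"
proof -
  have "(x + y)\<^sup>2 / (m1 + m2) \<le> x\<^sup>2 / m1 + y\<^sup>2 / m2"
  proof -
    have "x\<^sup>2 / m1 + y\<^sup>2 / m2 - (x + y)\<^sup>2 / (m1 + m2) = (x * m2 - y * m1)\<^sup>2 / (m1 * m2 * (m1 + m2))"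
      using assms by (simp add: field_simps power2_eq_square)
    also have "\<dots> \<ge> 0" using assms by simp
    finally show ?thesis by simp
  qed
  moreover have "x / m1 \<le> 1" "y / m2 \<le> 1" "0 \<le> (x + y) / (m1 + m2)"
    using assms by simp_all
  moreover have "(A - B - C - F + D + E) / 2 \<le> 1"
    if "A \<le> B + C" "D \<le> 1" "E \<le> 1" "0 \<le> F" for A B C D E F :: real
    using that by simp
  ultimately have le: "((x + y)\<^sup>2 / (m1 + m2) - x\<^sup>2 / m1 - y\<^sup>2 / m2 - (x + y) / (m1 + m2) + x / m1 + y / m2) / 2 \<le> 1"
    by blast
  have "(x + y) * (x + y - 1) / 2 / m - x * (x - 1) / 2 / m1 - y * (y - 1) / 2 / m2
    = ((x + y)\<^sup>2 / m - x\<^sup>2 / m1 - y\<^sup>2 / m2 - (x + y) / m + x / m1 + y / m2) / 2"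
    if "m > 0" for m
    using assms(1,2) that by (simp add: field_simps power2_eq_square)
  from this[OF add_pos_pos[OF assms(1,2)]] le show ?thesis by (simp only:)
qed

text \<open>Along the interpolation path the derivative is, up to a small correction, a quadratic
  expression in the numbers of frozen vertices in \<open>V\<close> and in \<open>W\<close>. Its
  convexity defect contributes \<open>c\<close> to the error. The other \<open>2 * c\<^sup>2\<close>
  comes from the factors \<open>1 / (1 - p t e)\<close> of the at most \<open>m\<^sup>2\<close>
  edges between the parts; the lower bounds on the sizes keep all probabilities below 1/2.\<close>

lemma mean_alpha_superadditive:
  fixes c :: real
  assumes V: "finite V" "finite W" "V \<inter> W = {}" and c: "c > 0"
    and large: "real (card V) \<ge> 2 * c" "real (card W) \<ge> 2 * c"
  shows "mean_alpha V (c / card V) + mean_alpha W (c / card W)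
     \<le> mean_alpha (V \<union> W) (c / card (V \<union> W)) + (c + 2 * c\<^sup>2)"
proof -
  define m1 m2 m where "m1 = real (card V)" and "m2 = real (card W)" and "m = m1 + m2"
  have m: "m1 > 0" "m2 > 0" "m1 \<ge> 2 * c" "m2 \<ge> 2 * c"
    using c large by (simp_all add: m1_def m2_def)
  have mU: "real (card (V \<union> W)) = m"
    using V by (simp add: m_def m1_def m2_def card_Un_disjoint)
  have m0: "m > 0" using m by (simp add: m_def)
  have small: "0 < c / m" "c / m < c / m1" "c / m < c / m2" "c / m1 \<le> 1/2" "c / m2 \<le> 1/2"
    using m c by (simp_all add: m_def field_simps)
  define U where "U = V \<union> W"
  have finU: "finite U" using V by (simp add: U_def)
  define C where "C = pairs U - pairs V - pairs W"
  have P: "pairs U = pairs V \<union> pairs W \<union> C" "pairs V \<inter> pairs W = {}"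
    "(pairs V \<union> pairs W) \<inter> C = {}" "finite C"
    using pairs_union[of V W] pairs_disjoint[OF V(3)] finU by (auto simp: C_def U_def)
  have Csub: "C \<subseteq> pairs U" by (auto simp: C_def)
  have split_sum: "sum g (pairs U) = sum g (pairs V) + sum g (pairs W) + sum g C" for g :: "nat set \<Rightarrow> real"
    unfolding P(1) by (simp add: sum.union_disjoint V P(2-4))
  \<comment> \<open>\<open>p 0\<close> is the disjoint union of two random graphs, \<open>p 1\<close> the random graph on \<open>U\<close>.\<close>
  define q where "q = (\<lambda>e. if e \<in> pairs V then c / m1 else if e \<in> pairs W then c / m2 else 0)"
  define p where "p = (\<lambda>t e. t * (c / m) + (1 - t) * q e)"
  define p' where "p' = (\<lambda>e. c / m - q e)"
  define f where "f = (\<lambda>E. real (alpha id U E))"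
  define F where "F = (\<lambda>t. bexp (pairs U) (p t) f)"
  define D where "D = (\<lambda>t. \<Sum>e\<in>pairs U. p' e * bexp (pairs U) (p t) (\<lambda>E. f (insert e E) - f (E - {e})))"
  have q: "q e = 0 \<or> q e = c / m1 \<or> q e = c / m2" for e by (simp add: q_def)
  have q01: "0 \<le> q e" "q e \<le> 1/2" for e
    using q[of e] small c m by (auto)
  have p01: "0 \<le> p t e" "p t e \<le> 1/2" if "0 \<le> t" "t \<le> 1" for t e
  proof -
    show "0 \<le> p t e" unfolding p_def
      by (intro add_nonneg_nonneg mult_nonneg_nonneg) (use that q01[of e] small in auto)
    have "t * (c / m) + (1 - t) * q e \<le> t * (1/2) + (1 - t) * (1/2)"
      by (intro add_mono mult_left_mono) (use that q01[of e] small(2,4) in linarith)+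
    also have "\<dots> = 1/2" by (simp add: field_simps)
    finally show "p t e \<le> 1/2" by (simp add: p_def)
  qed
  have derF: "(F has_real_derivative D t) (at t)" for t
    unfolding F_def D_def
    by (rule bexp_deriv) (use finU m0 in \<open>auto simp: p_def p'_def intro!: derivative_eq_intros\<close>)
  define K where "K = c + 2 * c\<^sup>2"
  have DK: "D t \<ge> - K" if t: "0 \<le> t" "t \<le> 1" for t
  proof -
    let ?B = "bexp (pairs U) (p t)"
    define h where "h = (\<lambda>e E. of_bool (e \<subseteq> frozen U E) :: real)"
    have prob: "\<And>e. e \<in> pairs U \<Longrightarrow> 0 \<le> p t e \<and> p t e \<le> 1"
      using p01[OF t] by (smt (verit) field_sum_of_halves)
    have h01: "0 \<le> ?B (h e)" "?B (h e) \<le> 1" for e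
      by (rule bexp_bounds[where l = 0 and u = 1]; use finU prob in \<open>auto simp: h_def\<close>)+
    have incr: "(1 - p t e) * ?B (\<lambda>E. f (insert e E) - f (E - {e})) = - ?B (h e)" if "e \<in> pairs U" for e
    proof -
      have "(1 - p t e) * ?B (\<lambda>E. f (insert e E) - f (E - {e})) = ?B (\<lambda>E. f (insert e E) - f E)"
        using bexp_insert_increment[of "pairs U" e] finU that by simp
      also have "\<dots> = ?B (\<lambda>E. (-1) * h e E)"
        by (rule bexp_cong) (use alpha_insert_edge[OF finU _ that] in \<open>auto simp: f_def h_def\<close>)
      finally show ?thesis by (simp only: bexp_cmult)
    qed
    have incr_ge: "p' e * ?B (\<lambda>E. f (insert e E) - f (E - {e})) \<ge> - p' e * ?B (h e) - (if e \<in> C then 2 * (c / m)\<^sup>2 else 0)"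
      if e: "e \<in> pairs U" for e
    proof -
      define X where "X = ?B (\<lambda>E. f (insert e E) - f (E - {e}))"
      have X: "X = - (?B (h e) / (1 - p t e))"
        using incr[OF e] p01[OF t, of e] by (simp add: X_def field_simps)
      have up: "?B (h e) \<le> ?B (h e) / (1 - p t e)"
        using h01[of e] p01[OF t, of e] by (simp add: field_simps mult_left_mono)
      \<comment> \<open>Inside the two parts \<open>p' e\<close> is negative, so that replacing the
        factor \<open>1 / (1 - p t e)\<close> by 1 goes in the right direction. Across the parts it
        loses a second order term.\<close>
      show ?thesis
      proof (cases "e \<in> C")
        case False
        then have "p' e \<le> 0" using e P small by (auto simp: p'_def q_def)
        then have "p' e * X \<ge> p' e * (- ?B (h e))"
          using up X by (intro mult_left_mono_neg) auto
        then show ?thesis using False by (simp add: X_def)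
      next
        case True
        then have qe: "q e = 0" by (auto simp: q_def C_def)
        have pe: "p t e \<le> c / m" using mult_right_mono[OF t(2), of "c / m"] small(1) qe by (simp add: p_def)
        have "?B (h e) / (1 - p t e) \<le> ?B (h e) * (1 + 2 * p t e)"
          using mult_left_mono[OF inverse_one_minus_le[OF p01[OF t, of e]] h01(1)[of e]] by simp
        also have "\<dots> = ?B (h e) + 2 * (?B (h e) * p t e)" by (simp add: distrib_left)
        also have "\<dots> \<le> ?B (h e) + 2 * (1 * (c / m))"
          by (intro add_left_mono mult_left_mono mult_mono) (use h01[of e] pe p01(1)[OF t, of e] in auto)
        finally have "X \<ge> - ?B (h e) - 2 * (c / m)" unfolding X by linarith
        then have "(c / m) * X \<ge> (c / m) * (- ?B (h e) - 2 * (c / m))"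
          using small by (intro mult_left_mono) auto
        then show ?thesis using True qe
          by (simp add: X_def p'_def algebra_simps power2_eq_square)
      qed
    qed
    have cardC: "real (card C) \<le> m\<^sup>2"
    proof -
      have "card C \<le> card (pairs U)" using finU by (intro card_mono) (auto simp: C_def)
      also have "\<dots> = card U choose 2" using finU by (rule card_pairs)
      finally have "real (card C) \<le> real (card U choose 2)" by simp
      also have "\<dots> = m * (m - 1) / 2"
        using mU by (simp add: U_def real_choose_two)
      also have "\<dots> \<le> m\<^sup>2" using m by (simp add: m_def power2_eq_square field_simps)
      finally show ?thesis .
    qed
    have "D t \<ge> (\<Sum>e\<in>pairs U. - p' e * ?B (h e) - (if e \<in> C then 2 * (c / m)\<^sup>2 else 0))"
      unfolding D_def by (rule sum_mono) (rule incr_ge)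
    also have "(\<Sum>e\<in>pairs U. - p' e * ?B (h e) - (if e \<in> C then 2 * (c / m)\<^sup>2 else 0))
       = ?B (\<lambda>E. \<Sum>e\<in>pairs U. - p' e * h e E) - real (card C) * (2 * (c / m)\<^sup>2)"
    proof -
      have "(\<Sum>e\<in>pairs U. if e \<in> C then 2 * (c / m)\<^sup>2 else 0) = (\<Sum>e\<in>C. 2 * (c / m)\<^sup>2)"
        using sum.inter_restrict[OF finite_pairs[OF finU], of "\<lambda>_. 2 * (c / m)\<^sup>2" C]
          Csub by (simp add: Int_absorb1)
      then show ?thesis by (simp add: sum_subtractf bexp_sum bexp_cmult bexp_uminus)
    qed
    finally have 1: "D t \<ge> ?B (\<lambda>E. \<Sum>e\<in>pairs U. - p' e * h e E) - real (card C) * (2 * (c / m)\<^sup>2)" .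
    have 2: "real (card C) * (2 * (c / m)\<^sup>2) \<le> 2 * c\<^sup>2"
      using mult_right_mono[OF cardC, of "2 * (c / m)\<^sup>2"] m
      by (simp add: m_def field_simps)
    have 3: "- c \<le> ?B (\<lambda>E. \<Sum>e\<in>pairs U. - p' e * h e E)"
    proof -
      \<comment> \<open>The bound holds for every graph \<open>E\<close> separately, because the sum
        depends on \<open>E\<close> only through the numbers of frozen vertices in the two
        parts.\<close>
      have "- c \<le> (\<Sum>e\<in>pairs U. - p' e * h e E)" for E
      proof -
        let ?O = "frozen U E"
        define x y where "x = real (card (V \<inter> ?O))" and "y = real (card (W \<inter> ?O))"
        have "card (U \<inter> ?O) = card (V \<inter> ?O \<union> W \<inter> ?O)" by (simp add: U_def Int_Un_distrib2)
        also have "\<dots> = card (V \<inter> ?O) + card (W \<inter> ?O)"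
          by (rule card_Un_disjoint) (use V in auto)
        finally have xy: "real (card (U \<inter> ?O)) = x + y" by (simp add: x_def y_def)
        have bnd: "x \<le> m1" "y \<le> m2" "0 \<le> x" "0 \<le> y"
          using V by (auto simp: x_def y_def m1_def m2_def intro: card_mono)
        have factor: "(c / m1) * X + (c / m2) * Y - (c / m) * Z = - c * (Z / m - X / m1 - Y / m2)" for X Y Z :: real
          by (simp add: algebra_simps)
        have hV: "(\<Sum>e\<in>pairs V. h e E) = x * (x - 1) / 2"
          unfolding h_def sum_subset_pairs[OF V(1)] real_choose_two x_def ..
        have hW: "(\<Sum>e\<in>pairs W. h e E) = y * (y - 1) / 2"
          unfolding h_def sum_subset_pairs[OF V(2)] real_choose_two y_def ..
        have hU: "(\<Sum>e\<in>pairs U. h e E) = (x + y) * (x + y - 1) / 2"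
          unfolding h_def sum_subset_pairs[OF finU] real_choose_two xy ..
        have "(\<Sum>e\<in>pairs U. - p' e * h e E) = (\<Sum>e\<in>pairs U. q e * h e E) - (c / m) * (\<Sum>e\<in>pairs U. h e E)"
          by (simp add: p'_def algebra_simps sum_subtractf sum_distrib_left)
        also have "(\<Sum>e\<in>pairs U. q e * h e E) = (\<Sum>e\<in>pairs V. q e * h e E) + (\<Sum>e\<in>pairs W. q e * h e E) + (\<Sum>e\<in>C. q e * h e E)"
          by (rule split_sum)
        also have "(\<Sum>e\<in>C. q e * h e E) = 0" by (auto simp: q_def C_def)
        also have "(\<Sum>e\<in>pairs V. q e * h e E) = (c / m1) * (\<Sum>e\<in>pairs V. h e E)"
          by (simp add: q_def sum_distrib_left)
        also have "(\<Sum>e\<in>pairs W. q e * h e E) = (c / m2) * (\<Sum>e\<in>pairs W. h e E)"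
          unfolding sum_distrib_left by (rule sum.cong) (use P(2) in \<open>auto simp: q_def\<close>)
        finally have "(\<Sum>e\<in>pairs U. - p' e * h e E)
          = (c / m1) * (x * (x - 1) / 2) + (c / m2) * (y * (y - 1) / 2) - (c / m) * ((x + y) * (x + y - 1) / 2)"
          by (simp only: hV hW hU)
        also have "\<dots> = - c * ((x + y) * (x + y - 1) / 2 / m - x * (x - 1) / 2 / m1 - y * (y - 1) / 2 / m2)"
          by (rule factor)
        also have "\<dots> \<ge> - c * 1"
          using interpolation_convexity[of m1 m2 x y] m bnd c unfolding m_def
          by (intro mult_left_mono_neg) auto
        finally show ?thesis by simp
      qed
      then have "?B (\<lambda>_. - c) \<le> ?B (\<lambda>E. \<Sum>e\<in>pairs U. - p' e * h e E)"
        by (intro bexp_mono prob) auto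
      then show ?thesis using finU by simp
    qed
    show ?thesis using 1 2 3 by (simp add: K_def)
  qed
  have "F 0 + K * 0 \<le> F 1 + K * 1"
  proof (rule DERIV_nonneg_imp_nondecreasing[where f = "\<lambda>t. F t + K * t"])
    fix t :: real assume t: "0 \<le> t" "t \<le> 1"
    have "((\<lambda>t. F t + K * t) has_real_derivative D t + K * 1) (at t)"
      by (intro DERIV_add derF DERIV_cmult DERIV_ident)
    then show "\<exists>y. ((\<lambda>t. F t + K * t) has_real_derivative y) (at t) \<and> 0 \<le> y"
      using DK[OF t] by (intro exI conjI) auto
  qed simp
  moreover have "F 1 = mean_alpha U (c / m)"
    by (simp add: F_def mean_alpha_def p_def f_def)
  moreover have "F 0 = mean_alpha V (c / m1) + mean_alpha W (c / m2)"
  proof -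
    have "F 0 = bexp (pairs V \<union> pairs W \<union> C) q f"
      by (simp add: F_def p_def P(1))
    also have "\<dots> = bexp (pairs V \<union> pairs W) q (\<lambda>E. bexp C q (\<lambda>H. f (E \<union> H)))"
      by (rule bexp_union) (use V P in auto)
    also have "\<dots> = bexp (pairs V \<union> pairs W) q f"
      by (subst bexp_zero) (use P(4) in \<open>auto simp: q_def C_def\<close>)
    also have "\<dots> = bexp (pairs V) q (\<lambda>E. bexp (pairs W) q (\<lambda>H. f (E \<union> H)))"
      by (rule bexp_union) (use V P in auto)
    also have "\<dots> = bexp (pairs V) q (\<lambda>E. bexp (pairs W) q (\<lambda>H. real (alpha id V E) + real (alpha id W H)))"
      using V by (intro bexp_cong) (auto simp: f_def U_def alpha_disjoint_union)
    also have "\<dots> = bexp (pairs V) q (\<lambda>E. real (alpha id V E)) + bexp (pairs W) q (\<lambda>H. real (alpha id W H))"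
      using V by (simp add: bexp_add)
    also have "bexp (pairs V) q (\<lambda>E. real (alpha id V E)) = mean_alpha V (c / m1)"
      unfolding mean_alpha_def by (rule bexp_cong) (auto simp: q_def)
    also have "bexp (pairs W) q (\<lambda>H. real (alpha id W H)) = mean_alpha W (c / m2)"
      unfolding mean_alpha_def by (rule bexp_cong) (use P(2) in \<open>auto simp: q_def\<close>)
    finally show ?thesis .
  qed
  ultimately show ?thesis
    using mU by (simp add: K_def m1_def m2_def U_def)
qed

text \<open>Fekete's lemma with an additive error: \<open>a n - K\<close> is superadditive in the
  strict sense, so its ratio to n tends to the supremum, and \<open>K / real n\<close>
  vanishes.\<close>

lemma fekete_superadditive:
  fixes a :: "nat \<Rightarrow> real"
  assumes super: "\<And>i j. i \<ge> n0 \<Longrightarrow> j \<ge> n0 \<Longrightarrow> a i + a j \<le> a (i + j) + K"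
    and nonneg: "\<And>i. i \<ge> n0 \<Longrightarrow> 0 \<le> a i" and le: "\<And>i. i \<ge> n0 \<Longrightarrow> a i \<le> real i" and "n0 > 0" "K \<ge> 0"
  shows "convergent (\<lambda>n. a n / real n)"
proof -
  define b where "b = (\<lambda>n. (a n - K) / real n)"
  define L where "L = (SUP n\<in>{n0..}. b n)"
  have bdd: "bdd_above (b ` {n0..})"
  proof (rule bdd_aboveI2[where M = 1])
    fix i assume "i \<in> {n0..}"
    then show "b i \<le> 1" using le[of i] \<open>n0 > 0\<close> \<open>K \<ge> 0\<close> by (simp add: b_def divide_le_eq)
  qed
  have up: "b i \<le> L" if "i \<ge> n0" for i
    unfolding L_def by (rule cSUP_upper[OF _ bdd]) (use that in auto)
  have rep: "real q * (a i - K) + (a r - K) \<le> a (q * i + r) - K" if "i \<ge> n0" "r \<ge> n0" for q i r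
  proof (induction q)
    case (Suc q)
    have "a i + a (q * i + r) \<le> a (i + (q * i + r)) + K"
      using that by (intro super) auto
    then show ?case using Suc by (simp add: algebra_simps)
  qed simp
  have "b \<longlonglongrightarrow> L"
  proof (rule LIMSEQ_I)
    fix e :: real assume e: "e > 0"
    have "\<exists>i\<in>{n0..}. L - e / 2 < b i"
      using less_cSUP_iff[OF _ bdd, of "L - e / 2"] e \<open>n0 > 0\<close> unfolding L_def by fastforce
    then obtain i where i: "i \<ge> n0" "L - e / 2 < b i" by auto
    have i0: "i > 0" using i \<open>n0 > 0\<close> by simp
    define M where "M = 2 * real i * \<bar>b i\<bar> + K + 1"
    have M: "M > 0" using \<open>K \<ge> 0\<close> by (simp add: M_def add_nonneg_pos)
    obtain n1 :: nat where n1: "2 * M / e < real n1" using reals_Archimedean2 by blast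
    show "\<exists>no. \<forall>n\<ge>no. norm (b n - L) < e"
    proof (intro exI allI impI)
      fix n assume n: "n \<ge> max n1 (2 * i)"
      \<comment> \<open>Shifting the remainder up by \<open>i\<close> keeps it at least
        \<open>n0\<close>, the range where superadditivity is known, and still below
        \<open>2 * i\<close>.\<close>
      define q r where "q = n div i - 1" and "r = i + n mod i"
      have "n div i \<ge> 1" using n i0 by (simp add: Suc_le_eq div_greater_zero_iff)
      then have nq: "n = q * i + r"
        using div_mult_mod_eq[of n i] by (cases "n div i") (simp_all add: q_def r_def)
      have r: "r \<ge> n0" "r < 2 * i" using i i0 by (simp_all add: r_def)
      have n0': "real n > 0" using n i0 by simp
      have bi: "a i - K = b i * real i" and bn: "a n - K = b n * real n"
        using i0 n0' by (simp_all add: b_def)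
      have qi: "real q * real i = real n - real r"
        using nq by (metis add_diff_cancel_right' of_nat_add of_nat_mult)
      have "real q * (a i - K) - K \<le> a n - K"
        using rep[OF i(1) r(1), of q] nonneg[OF r(1)] nq by simp
      then have "(real q * real i) * b i - K \<le> b n * real n"
        unfolding bi bn by (simp only: mult_ac)
      then have "(real n - real r) * b i - K \<le> b n * real n"
        unfolding qi .
      moreover have "real r * b i \<le> 2 * real i * \<bar>b i\<bar>"
      proof -
        have "real r * b i \<le> real r * \<bar>b i\<bar>" by (intro mult_left_mono) auto
        also have "\<dots> \<le> 2 * real i * \<bar>b i\<bar>" by (intro mult_right_mono) (use r in auto)
        finally show ?thesis .
      qed
      ultimately have "real n * b i - M \<le> b n * real n" by (simp add: M_def algebra_simps)
      then have "b i - M / real n \<le> b n" using n0' by (simp add: field_simps)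
      moreover have "M / real n < e / 2"
      proof -
        have "2 * M / e < real n" using n n1 by simp
        then show ?thesis using e n0' by (simp add: field_simps)
      qed
      ultimately have "L - e < b n" using i(2) by linarith
      moreover have "b n \<le> L" using n i by (intro up) simp
      ultimately show "norm (b n - L) < e" by simp
    qed
  qed
  moreover have "(\<lambda>n. K / real n) \<longlonglongrightarrow> 0" by real_asymp
  ultimately have "(\<lambda>n. b n + K / real n) \<longlonglongrightarrow> L + 0" by (rule tendsto_add)
  moreover have "b n + K / real n = a n / real n" for n by (simp add: b_def diff_divide_distrib)
  ultimately show ?thesis by (auto simp: convergent_def)
qed

lemma mean_alpha_bounds:
  assumes "finite V" "0 \<le> p" "p \<le> 1"
  shows "0 \<le> mean_alpha V p" "mean_alpha V p \<le> card V"
  unfolding mean_alpha_def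
  by (rule bexp_bounds[where l = 0 and u = "real (card V)"]; use assms alpha_le_card in auto)+

lemma mean_alpha_convergent:
  assumes "c > 0"
  shows "convergent (\<lambda>n. mean_alpha {..<n} (c / n) / real n)"
proof (rule fekete_superadditive)
  fix i j :: nat assume ij: "nat \<lceil>2 * c\<rceil> \<le> i" "nat \<lceil>2 * c\<rceil> \<le> j"
  have W: "{i..<i + j} = (+) i ` {..<j}" by (simp add: lessThan_atLeast0 add.commute)
  have "mean_alpha {..<i} (c / card {..<i}) + mean_alpha {i..<i+j} (c / card {i..<i+j})
    \<le> mean_alpha ({..<i} \<union> {i..<i+j}) (c / card ({..<i} \<union> {i..<i+j})) + (c + 2 * c\<^sup>2)"
    by (rule mean_alpha_superadditive) (use assms ij in \<open>auto simp: nat_le_iff ceiling_le_iff\<close>)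
  moreover have "{..<i} \<union> {i..<i+j} = {..<i+j}" by auto
  moreover have "mean_alpha {i..<i+j} p = mean_alpha {..<j} p" for p
    unfolding W by (rule mean_alpha_image) auto
  ultimately show "mean_alpha {..<i} (c / i) + mean_alpha {..<j} (c / j)
    \<le> mean_alpha {..<i+j} (c / real (i + j)) + (c + 2 * c\<^sup>2)" by simp
next
  fix i :: nat assume i: "nat \<lceil>2 * c\<rceil> \<le> i"
  then have "c / i \<le> 1" using assms by (simp add: nat_le_iff ceiling_le_iff divide_le_eq)
  then show "0 \<le> mean_alpha {..<i} (c / i)" "mean_alpha {..<i} (c / i) \<le> real i"
    using mean_alpha_bounds[of "{..<i}" "c / i"] assms by auto
qed (use assms in auto)

section \<open>Existence of the threshold\<close>

lemma max_image_pair_less: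
  assumes "finite V" "b ` V \<subseteq> {..<N::nat}" "e \<in> pairs V"
  shows "Max (b ` e) < N"
  using assms by (auto simp: pairs_def card_2_iff image_subset_iff)

lemma alpha_upper_tail:
  assumes "finite V" "b ` V \<subseteq> {..<N::nat}" "N > 0" "0 \<le> p" "p \<le> 1" "0 \<le> t" "t \<le> 2 * real N"
  shows "bexp (pairs V) (\<lambda>_. p)
      (\<lambda>E. of_bool (real (alpha b V E) \<ge> bexp (pairs V) (\<lambda>_. p) (\<lambda>E. real (alpha b V E)) + t))
     \<le> exp (- (t\<^sup>2 / (4 * real N)))"
  by (rule bounded_differences_tail[OF _ _ _ bounded_differences_alpha[of V b]])
    (use assms max_image_pair_less[OF assms(1,2)] in auto)

lemma alpha_lower_tail:
  assumes "finite V" "b ` V \<subseteq> {..<N::nat}" "N > 0" "0 \<le> p" "p \<le> 1" "0 \<le> t" "t \<le> 2 * real N"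
  shows "bexp (pairs V) (\<lambda>_. p)
      (\<lambda>E. of_bool (real (alpha b V E) \<le> bexp (pairs V) (\<lambda>_. p) (\<lambda>E. real (alpha b V E)) - t))
     \<le> exp (- (t\<^sup>2 / (4 * real N)))"
  by (rule bounded_differences_lower_tail[OF _ _ _ bounded_differences_alpha[of V b]])
    (use assms max_image_pair_less[OF assms(1,2)] in auto)

lemma exists_indep_set_iff:
  assumes "finite V"
  shows "(\<exists>S\<in>indep_sets b V E. card S = m) \<longleftrightarrow> m \<le> alpha b V E"
proof
  assume "\<exists>S\<in>indep_sets b V E. card S = m"
  then show "m \<le> alpha b V E" using card_le_alpha[OF assms] by metis
next
  assume m: "m \<le> alpha b V E"
  obtain S where S: "S \<in> indep_sets b V E" "card S = alpha b V E"
    by (rule alpha_attained[OF assms])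
  then obtain T where "T \<subseteq> S" "card T = m"
    using m by (metis obtain_subset_with_card_n)
  with S show "\<exists>S\<in>indep_sets b V E. card S = m"
    by (intro bexI[of _ T]) (auto simp: indep_sets_def intro: indep_mono inj_on_subset)
qed

lemma indep_prob_eq:
  assumes "0 \<le> c" "c \<le> real n"
  shows "indep_prob c \<alpha> n =
    bexp (pairs {..<n}) (\<lambda>_. c / n) (\<lambda>E. of_bool (nat \<lceil>\<alpha> * real n\<rceil> \<le> alpha id {..<n} E))"
proof -
  have "independent_set n E S \<longleftrightarrow> S \<in> indep_sets id {..<n} E" for E S
    by (simp add: independent_set_def indep_sets_def indep_def)
  then have "(\<exists>S. independent_set n E S \<and> card S = m) \<longleftrightarrow> m \<le> alpha id {..<n} E" for E m
    using exists_indep_set_iff[of "{..<n}" id E m] by auto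
  moreover have "c / real n \<le> 1" using assms by (cases "n = 0") auto
  ultimately show ?thesis
    unfolding indep_prob_def using assms by (subst prob_gnp) (auto simp: vertex_pairs_eq)
qed

definition indep_ratio :: "real \<Rightarrow> real" where
  "indep_ratio c = lim (\<lambda>n. mean_alpha {..<n} (c / n) / real n)"

lemma mean_alpha_tendsto:
  "c > 0 \<Longrightarrow> (\<lambda>n. mean_alpha {..<n} (c / n) / real n) \<longlonglongrightarrow> indep_ratio c"
  unfolding indep_ratio_def using mean_alpha_convergent convergent_LIMSEQ_iff by blast

lemma indep_prob_tendsto_1:
  assumes "c > 0" "\<alpha> < indep_ratio c"
  shows "indep_prob c \<alpha> \<longlonglongrightarrow> 1"
proof -
  \<comment> \<open>One half of the distance absorbs the convergence of the mean, the other the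
    random deviation. The cap at 1 makes \<open>d * real n\<close> admissible in the tail
    bound.\<close>
  define d where "d = min 1 ((indep_ratio c - \<alpha>) / 2)"
  have d: "0 < d" "d \<le> 1" "2 * d \<le> indep_ratio c - \<alpha>" using assms by (auto simp: d_def min_def)
  have ev: "\<forall>\<^sub>F n in sequentially. mean_alpha {..<n} (c / n) / real n > indep_ratio c - d"
    using order_tendstoD(1)[OF mean_alpha_tendsto[OF assms(1)]] d by simp
  have bound: "\<forall>\<^sub>F n in sequentially. 1 - exp (- (d\<^sup>2 / 4 * real n)) \<le> indep_prob c \<alpha> n"
    using ev eventually_ge_at_top[of "nat \<lceil>c\<rceil>"] eventually_gt_at_top[of 0]
  proof eventually_elim
    case (elim n)
    have cn: "c \<le> real n" "0 \<le> c / n" "c / n \<le> 1"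
      using elim assms by (auto simp: nat_le_iff ceiling_le_iff divide_le_eq)
    let ?B = "bexp (pairs {..<n}) (\<lambda>_. c / n)"
    have mean: "\<alpha> * real n \<le> mean_alpha {..<n} (c / n) - d * real n"
    proof -
      have "\<alpha> + d \<le> mean_alpha {..<n} (c / n) / real n" using elim(1) d by simp
      then show ?thesis using elim(3) by (simp add: field_simps)
    qed
    have "1 - indep_prob c \<alpha> n = ?B (\<lambda>E. 1 - of_bool (nat \<lceil>\<alpha> * real n\<rceil> \<le> alpha id {..<n} E))"
      using indep_prob_eq[of c n \<alpha>] assms cn by (simp add: bexp_diff)
    also have "\<dots> \<le> ?B (\<lambda>E. of_bool (real (alpha id {..<n} E) \<le> mean_alpha {..<n} (c / n) - d * real n))"
    proof (rule bexp_mono)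
      fix E
      have "real (alpha id {..<n} E) \<le> mean_alpha {..<n} (c / n) - d * real n"
        if "\<not> nat \<lceil>\<alpha> * real n\<rceil> \<le> alpha id {..<n} E"
      proof -
        have "int (alpha id {..<n} E) < \<lceil>\<alpha> * real n\<rceil>" using that by linarith
        then have "real (alpha id {..<n} E) < \<alpha> * real n" by (simp add: less_ceiling_iff)
        then show ?thesis using mean by simp
      qed
      then show "1 - of_bool (nat \<lceil>\<alpha> * real n\<rceil> \<le> alpha id {..<n} E)
         \<le> (of_bool (real (alpha id {..<n} E) \<le> mean_alpha {..<n} (c / n) - d * real n) :: real)"
        by auto
    qed (use cn in auto)
    also have "\<dots> \<le> exp (- ((d * real n)\<^sup>2 / (4 * real n)))"
      unfolding mean_alpha_def
      by (rule alpha_lower_tail) (use cn d elim in \<open>auto simp: mult_left_le_one_le\<close>)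
    also have "(d * real n)\<^sup>2 / (4 * real n) = d\<^sup>2 / 4 * real n"
      using elim by (simp add: power2_eq_square)
    finally show ?case by simp
  qed
  have le1: "\<forall>\<^sub>F n in sequentially. indep_prob c \<alpha> n \<le> 1"
    unfolding indep_prob_def by simp
  have "(\<lambda>n. 1 - exp (- (d\<^sup>2 / 4 * real n))) \<longlonglongrightarrow> 1"
    using d by real_asymp
  then show ?thesis
    by (rule tendsto_sandwich[OF bound le1]) simp
qed

lemma indep_prob_tendsto_0:
  assumes "c > 0" "\<alpha> > indep_ratio c"
  shows "indep_prob c \<alpha> \<longlonglongrightarrow> 0"
proof -
  define d where "d = min 1 ((\<alpha> - indep_ratio c) / 2)"
  have d: "0 < d" "d \<le> 1" "2 * d \<le> \<alpha> - indep_ratio c" using assms by (auto simp: d_def min_def)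
  have ev: "\<forall>\<^sub>F n in sequentially. mean_alpha {..<n} (c / n) / real n < indep_ratio c + d"
    using order_tendstoD(2)[OF mean_alpha_tendsto[OF assms(1)]] d by simp
  have bound: "\<forall>\<^sub>F n in sequentially. indep_prob c \<alpha> n \<le> exp (- (d\<^sup>2 / 4 * real n))"
    using ev eventually_ge_at_top[of "nat \<lceil>c\<rceil>"] eventually_gt_at_top[of 0]
  proof eventually_elim
    case (elim n)
    have cn: "c \<le> real n" "0 \<le> c / n" "c / n \<le> 1"
      using elim assms by (auto simp: nat_le_iff ceiling_le_iff divide_le_eq)
    let ?B = "bexp (pairs {..<n}) (\<lambda>_. c / n)"
    have mean: "mean_alpha {..<n} (c / n) + d * real n \<le> \<alpha> * real n"
    proof -
      have "mean_alpha {..<n} (c / n) / real n \<le> \<alpha> - d" using elim(1) d by simp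
      then show ?thesis using elim(3) by (simp add: field_simps)
    qed
    have "indep_prob c \<alpha> n = ?B (\<lambda>E. of_bool (nat \<lceil>\<alpha> * real n\<rceil> \<le> alpha id {..<n} E))"
      using indep_prob_eq[of c n \<alpha>] assms cn by simp
    also have "\<dots> \<le> ?B (\<lambda>E. of_bool (real (alpha id {..<n} E) \<ge> mean_alpha {..<n} (c / n) + d * real n))"
    proof (rule bexp_mono)
      fix E
      have "real (alpha id {..<n} E) \<ge> mean_alpha {..<n} (c / n) + d * real n"
        if "nat \<lceil>\<alpha> * real n\<rceil> \<le> alpha id {..<n} E"
        using that mean by linarith
      then show "of_bool (nat \<lceil>\<alpha> * real n\<rceil> \<le> alpha id {..<n} E)
         \<le> (of_bool (real (alpha id {..<n} E) \<ge> mean_alpha {..<n} (c / n) + d * real n) :: real)"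
        by auto
    qed (use cn in auto)
    also have "\<dots> \<le> exp (- ((d * real n)\<^sup>2 / (4 * real n)))"
      unfolding mean_alpha_def
      by (rule alpha_upper_tail) (use cn d elim in \<open>auto simp: mult_left_le_one_le\<close>)
    also have "(d * real n)\<^sup>2 / (4 * real n) = d\<^sup>2 / 4 * real n"
      using elim by (simp add: power2_eq_square)
    finally show ?case by simp
  qed
  have ge0: "\<forall>\<^sub>F n in sequentially. 0 \<le> indep_prob c \<alpha> n"
    unfolding indep_prob_def by simp
  have "(\<lambda>n. exp (- (d\<^sup>2 / 4 * real n))) \<longlonglongrightarrow> 0"
    using d by real_asymp
  then show ?thesis
    by (intro tendsto_sandwich[OF ge0 bound]) simp_all
qed

lemma alpha_crit_eq:
  assumes "c > 0"
  shows "alpha_crit c = indep_ratio c"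
  unfolding alpha_crit_def
proof (rule the_equality)
  show thr: "is_indep_threshold c (indep_ratio c)"
    using indep_prob_tendsto_1 indep_prob_tendsto_0 assms by (simp add: is_indep_threshold_def)
  fix a assume a: "is_indep_threshold c a"
  \<comment> \<open>Between two different thresholds the probability would tend to both 1 and
    0.\<close>
  have False if "x < y" "is_indep_threshold c x" "is_indep_threshold c y" for x y
  proof -
    have "indep_prob c ((x + y) / 2) \<longlonglongrightarrow> 1" "indep_prob c ((x + y) / 2) \<longlonglongrightarrow> 0"
      using that by (auto simp: is_indep_threshold_def)
    then show False using LIMSEQ_unique by fastforce
  qed
  then show "a = indep_ratio c" using a thr by (meson linorder_neqE_linordered_idom)
qed

section \<open>First moment upper bound\<close>

lemma bexp_indep:
  assumes "finite V" "S \<subseteq> V"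
  shows "bexp (pairs V) (\<lambda>_. p) (\<lambda>E. of_bool (indep E S)) = (1 - p) ^ (card S choose 2)"
proof -
  have fin: "finite S" using assms finite_subset by blast
  have "bexp (pairs V) (\<lambda>_. p) (\<lambda>E. of_bool (indep E S))
      = bexp (pairs V) (\<lambda>_. p) (\<lambda>E. of_bool (E \<inter> pairs S = {}))"
    by (rule bexp_cong) (simp_all add: indep_iff)
  also have "\<dots> = (\<Prod>e\<in>pairs S. 1 - p)"
    by (rule bexp_avoid) (use assms in \<open>auto simp: pairs_def\<close>)
  finally show ?thesis using fin by (simp add: card_pairs)
qed

lemma first_moment_bound:
  assumes "0 \<le> p" "p \<le> 1"
  shows "bexp (pairs {..<n}) (\<lambda>_. p) (\<lambda>E. of_bool (m \<le> alpha id {..<n} E))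
    \<le> 2 ^ n * exp (- p * real (m choose 2))"
proof -
  let ?B = "bexp (pairs {..<n}) (\<lambda>_. p)"
  define F where "F = {S. S \<subseteq> {..<n} \<and> card S = m}"
  have finF: "finite F" by (rule finite_subset[of _ "Pow {..<n}"]) (auto simp: F_def)
  have cardF: "card F \<le> 2 ^ n"
  proof -
    have "card F \<le> card (Pow {..<n})" by (rule card_mono) (auto simp: F_def)
    then show ?thesis by (simp add: card_Pow)
  qed
  have cardF': "real (card F) \<le> 2 ^ n"
    using of_nat_mono[OF cardF, where 'a = real] by simp
  have "?B (\<lambda>E. of_bool (m \<le> alpha id {..<n} E)) \<le> ?B (\<lambda>E. \<Sum>S\<in>F. of_bool (indep E S))"
  proof (rule bexp_mono)
    fix E
    show "of_bool (m \<le> alpha id {..<n} E) \<le> (\<Sum>S\<in>F. of_bool (indep E S) :: real)"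
    proof (cases "m \<le> alpha id {..<n} E")
      case True
      then obtain S where S: "S \<in> F" "indep E S"
        using exists_indep_set_iff[of "{..<n}" id E m] by (auto simp: F_def indep_sets_def)
      then have "of_bool (indep E S) \<le> (\<Sum>S\<in>F. of_bool (indep E S) :: real)"
        by (intro member_le_sum) (use finF in auto)
      then show ?thesis using S True by simp
    qed (simp add: sum_nonneg)
  qed (use assms in auto)
  also have "\<dots> = (\<Sum>S\<in>F. (1 - p) ^ (m choose 2))"
    unfolding bexp_sum by (rule sum.cong) (auto simp: F_def bexp_indep)
  also have "\<dots> = real (card F) * (1 - p) ^ (m choose 2)" by simp
  also have "\<dots> \<le> 2 ^ n * exp (- p) ^ (m choose 2)"
    by (intro mult_mono power_mono) (use cardF' assms exp_ge_add_one_self[of "- p"] in auto)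
  also have "exp (- p) ^ (m choose 2) = exp (- p * real (m choose 2))"
    by (simp add: exp_of_nat_mult[symmetric] mult.commute)
  finally show ?thesis .
qed

text \<open>A union bound over all vertex sets is enough, since only some upper bound on c is
  wanted. It is applied at \<alpha>/2, which lies strictly below the ratio even if the ratio is
  exactly \<alpha>. The constant 16 arises from m \<ge> \<alpha> n / 2 and m - 1 \<ge> \<alpha> n /
  4, which give \<open>m choose 2\<close> at least \<alpha>^2 n^2 / 16, together with ln 2 <
  1.\<close>

lemma indep_ratio_less:
  assumes "\<alpha> > 0" "c > 16 / \<alpha>\<^sup>2"
  shows "indep_ratio c < \<alpha>"
proof (rule ccontr)
  assume "\<not> indep_ratio c < \<alpha>"
  then have "\<alpha> / 2 < indep_ratio c" using assms by simp
  have c0: "c > 0" using assms by (smt (verit) divide_nonneg_nonneg zero_le_power2)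
  then have one: "indep_prob c (\<alpha> / 2) \<longlonglongrightarrow> 1"
    using indep_prob_tendsto_1 \<open>\<alpha> / 2 < indep_ratio c\<close> by simp
  have key: "ln 2 - c * \<alpha>\<^sup>2 / 16 < 0"
  proof -
    have "16 < c * \<alpha>\<^sup>2" using assms by (simp add: divide_less_eq)
    then show ?thesis using ln_2_less_1 by simp
  qed
  have bound: "\<forall>\<^sub>F n in sequentially. indep_prob c (\<alpha> / 2) n \<le> exp ((ln 2 - c * \<alpha>\<^sup>2 / 16) * real n)"
    using eventually_ge_at_top[of "nat \<lceil>c\<rceil>"] eventually_ge_at_top[of "nat \<lceil>4 / \<alpha>\<rceil>"] eventually_gt_at_top[of 0]
  proof eventually_elim
    case (elim n)
    have cn: "c \<le> real n" "0 \<le> c / n" "c / n \<le> 1"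
      using elim c0 by (auto simp: nat_le_iff ceiling_le_iff divide_le_eq)
    have "4 / \<alpha> \<le> real n" using elim by (simp add: nat_le_iff ceiling_le_iff)
    then have an: "1 \<le> \<alpha> * real n / 4" using assms by (simp add: divide_le_eq mult.commute)
    define m where "m = nat \<lceil>\<alpha> / 2 * real n\<rceil>"
    have m: "real m \<ge> \<alpha> / 2 * real n" unfolding m_def by linarith
    have "\<alpha>\<^sup>2 * (real n)\<^sup>2 / 16 = (\<alpha> / 2 * real n) * (\<alpha> * real n / 4) / 2"
      by (simp add: power2_eq_square)
    also have "\<dots> \<le> real m * (real m - 1) / 2"
      using m an by (intro divide_right_mono mult_mono) auto
    finally have ch: "\<alpha>\<^sup>2 * (real n)\<^sup>2 / 16 \<le> real (m choose 2)" by (simp add: real_choose_two)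
    have "indep_prob c (\<alpha> / 2) n \<le> 2 ^ n * exp (- (c / n) * real (m choose 2))"
      using first_moment_bound[of "c / n" n m] cn c0 by (simp add: indep_prob_eq m_def)
    also have "\<dots> \<le> 2 ^ n * exp (- (c / n) * (\<alpha>\<^sup>2 * (real n)\<^sup>2 / 16))"
      using mult_left_mono[OF ch cn(2)] by simp
    also have "\<dots> = exp (real n * ln 2) * exp (- (c * \<alpha>\<^sup>2 / 16) * real n)"
      using elim by (simp add: exp_of_nat_mult power2_eq_square)
    also have "\<dots> = exp ((ln 2 - c * \<alpha>\<^sup>2 / 16) * real n)"
      by (simp add: exp_add[symmetric] algebra_simps)
    finally show ?case .
  qed
  have ge0: "\<forall>\<^sub>F n in sequentially. 0 \<le> indep_prob c (\<alpha> / 2) n"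
    unfolding indep_prob_def by simp
  have "(\<lambda>n. exp ((ln 2 - c * \<alpha>\<^sup>2 / 16) * real n)) \<longlonglongrightarrow> 0"
    using key by real_asymp
  then have "indep_prob c (\<alpha> / 2) \<longlonglongrightarrow> 0"
    by (intro tendsto_sandwich[OF ge0 bound]) simp_all
  with one show False using LIMSEQ_unique by fastforce
qed

text \<open>A real \<open>Sup\<close> bounds its members only if the set is bounded above, which
  \<open>indep_ratio_less\<close> provides.\<close>

lemma c_crit_ge:
  assumes "\<alpha> > 0" "c > 0" "indep_ratio c \<ge> \<alpha>"
  shows "c_crit \<alpha> \<ge> c"
  unfolding c_crit_def
proof (rule cSup_upper)
  show "c \<in> {c. c > 0 \<and> alpha_crit c \<ge> \<alpha>}" using assms alpha_crit_eq by simp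
  show "bdd_above {c. c > 0 \<and> alpha_crit c \<ge> \<alpha>}"
  proof (rule bdd_aboveI[where M = "16 / \<alpha>\<^sup>2"])
    fix d assume "d \<in> {c. c > 0 \<and> alpha_crit c \<ge> \<alpha>}"
    then have "\<alpha> \<le> indep_ratio d" using alpha_crit_eq[of d] by simp
    then show "d \<le> 16 / \<alpha>\<^sup>2" using indep_ratio_less[OF assms(1), of d] by linarith
  qed
qed

section \<open>Second moment for block sets\<close>

text \<open>The set \<open>A\<close> of admissible blocks is arbitrary so that blocks can be added
  one by one in the count, and the blocks already occupied by a given set can be removed.\<close>

definition block_sets :: "nat \<Rightarrow> nat set \<Rightarrow> nat \<Rightarrow> nat set set" where
  "block_sets k A m = {S. finite S \<and> inj_on (\<lambda>v. v div k) S \<and> (\<lambda>v. v div k) ` S \<subseteq> A \<and> card S = m}"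

lemma block_eq:
  fixes a k :: nat
  assumes "k > 0"
  shows "{v. v div k = a} = {a * k..<a * k + k}"
proof -
  have "v div k = a \<longleftrightarrow> a * k \<le> v \<and> v < a * k + k" for v
  proof
    assume "v div k = a"
    then have "a * k + v mod k = v" using div_mult_mod_eq[of v k] by simp
    then show "a * k \<le> v \<and> v < a * k + k"
      using mod_less_divisor[OF assms, of v] by linarith
  next
    assume "a * k \<le> v \<and> v < a * k + k"
    then show "v div k = a" by (intro div_nat_eqI) (simp_all add: mult.commute)
  qed
  then show ?thesis by (intro set_eqI) (simp only: mem_Collect_eq atLeastLessThan_iff)
qed

lemma finite_block_sets:
  assumes "finite A" "k > 0"
  shows "finite (block_sets k A m)"
proof -
  have "{v. v div k \<in> A} = (\<Union>a\<in>A. {v. v div k = a})" by auto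
  then have "finite {v. v div k \<in> A}" using assms by (simp add: block_eq)
  then have "finite (Pow {v. v div k \<in> A})" by simp
  then show ?thesis by (rule finite_subset[rotated]) (auto simp: block_sets_def)
qed

lemma card_block_sets:
  assumes "finite A" "k > 0"
  shows "card (block_sets k A m) = (card A choose m) * k ^ m"
  using assms(1)
proof (induction A arbitrary: m rule: finite_induct)
  case empty
  have "block_sets k {} m = (if m = 0 then {{}} else {})"
    by (auto simp: block_sets_def)
  then show ?case by (cases m) auto
next
  case (insert a A)
  show ?case
  proof (cases m)
    case 0
    have "block_sets k (insert a A) 0 = {{}}" by (auto simp: block_sets_def)
    then show ?thesis using 0 by simp
  next
    case (Suc l)
    let ?D = "{v. v div k = a}"
    let ?g = "\<lambda>(v, S). insert v S"
    have notin: "v \<notin> S" if "v \<in> ?D" "S \<in> block_sets k A j" for v S j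
      using that insert.hyps by (auto simp: block_sets_def)
    have split: "block_sets k (insert a A) m = block_sets k A m \<union> ?g ` (?D \<times> block_sets k A l)"
    proof (intro set_eqI iffI)
      fix S assume S: "S \<in> block_sets k (insert a A) m"
      show "S \<in> block_sets k A m \<union> ?g ` (?D \<times> block_sets k A l)"
      proof (cases "\<exists>v\<in>S. v div k = a")
        case False
        then show ?thesis using S by (auto simp: block_sets_def)
      next
        case True
        then obtain v where v: "v \<in> S" "v div k = a" by auto
        have "S - {v} \<in> block_sets k A l"
          using S v Suc by (auto simp: block_sets_def inj_on_def)
        then have "?g (v, S - {v}) \<in> ?g ` (?D \<times> block_sets k A l)" using v by blast
        then show ?thesis using v by (simp add: insert_absorb)
      qed
    next
      fix S assume "S \<in> block_sets k A m \<union> ?g ` (?D \<times> block_sets k A l)"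
      then show "S \<in> block_sets k (insert a A) m"
      proof
        assume "S \<in> block_sets k A m"
        then show ?thesis by (auto simp: block_sets_def)
      next
        assume "S \<in> ?g ` (?D \<times> block_sets k A l)"
        then obtain v T where vT: "S = insert v T" "v \<in> ?D" "T \<in> block_sets k A l" by auto
        have "v div k \<notin> (\<lambda>v. v div k) ` T"
          using vT insert.hyps by (auto simp: block_sets_def)
        then show ?thesis
          using vT notin[OF vT(2,3)] Suc by (auto simp: block_sets_def)
      qed
    qed
    have inj: "inj_on ?g (?D \<times> block_sets k A l)"
    proof (rule inj_onI, clarify)
      fix v S w T assume *: "insert v S = insert w T" "S \<in> block_sets k A l" "T \<in> block_sets k A l" "a = v div k" "w div k = v div k"
      have "v \<notin> T" "w \<notin> S" "v \<notin> S" "w \<notin> T"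
        using notin[of v] notin[of w] * by auto
      then show "v = w \<and> S = T" using *(1) by auto
    qed
    have disj: "block_sets k A m \<inter> ?g ` (?D \<times> block_sets k A l) = {}"
      using insert.hyps by (auto simp: block_sets_def)
    have "card (block_sets k (insert a A) m) = card (block_sets k A m) + card (?g ` (?D \<times> block_sets k A l))"
      unfolding split using insert.hyps assms(2)
      by (intro card_Un_disjoint disj finite_imageI finite_cartesian_product finite_block_sets)
        (auto simp: block_eq)
    also have "card (?g ` (?D \<times> block_sets k A l)) = card (?D \<times> block_sets k A l)"
      by (rule card_image[OF inj])
    also have "card (block_sets k A m) + card (?D \<times> block_sets k A l)
        = (card A choose m) * k ^ m + k * ((card A choose l) * k ^ l)"
      using insert.IH assms(2) by (simp add: card_cartesian_product block_eq)
    also have "\<dots> = (card (insert a A) choose m) * k ^ m"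
      using insert.hyps Suc by (simp add: algebra_simps)
    finally show ?thesis .
  qed
qed

text \<open>The rest \<open>S - T\<close> avoids every block met by \<open>T\<close>, since
  \<open>S\<close> has one vertex per block; so it is a block set over the remaining blocks.\<close>

lemma card_block_sets_superset:
  assumes "finite A" "k > 0" "T \<in> block_sets k A j"
  shows "card {S \<in> block_sets k A s. T \<subseteq> S} \<le> ((card A - j) choose (s - j)) * k ^ (s - j)"
proof -
  let ?b = "\<lambda>v. v div k"
  let ?A = "A - ?b ` T"
  have T: "finite T" "inj_on ?b T" "?b ` T \<subseteq> A" "card T = j"
    using assms(3) by (auto simp: block_sets_def)
  have "card {S \<in> block_sets k A s. T \<subseteq> S} \<le> card (block_sets k ?A (s - j))"
  proof (rule card_inj_on_le[where f = "\<lambda>S. S - T"])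
    show "inj_on (\<lambda>S. S - T) {S \<in> block_sets k A s. T \<subseteq> S}"
      by (auto simp: inj_on_def)
    show "(\<lambda>S. S - T) ` {S \<in> block_sets k A s. T \<subseteq> S} \<subseteq> block_sets k ?A (s - j)"
    proof clarify
      fix S assume S: "S \<in> block_sets k A s" "T \<subseteq> S"
      then have inj: "inj_on ?b S" and fin: "finite S" by (auto simp: block_sets_def)
      have "?b v \<notin> ?b ` T" if "v \<in> S - T" for v
        using that inj S(2) by (auto simp: inj_on_def)
      then show "S - T \<in> block_sets k ?A (s - j)"
        using S T by (auto simp: block_sets_def card_Diff_subset intro: inj_on_subset)
    qed
    show "finite (block_sets k ?A (s - j))" using assms by (intro finite_block_sets) auto
  qed
  also have "\<dots> = (card ?A choose (s - j)) * k ^ (s - j)"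
    using assms by (intro card_block_sets) auto
  also have "card ?A = card A - j"
    using T by (simp add: card_Diff_subset card_image)
  finally show ?thesis .
qed

text \<open>A union bound over the possible intersections \<open>T\<close>, each a subset of
  \<open>S\<close> with \<open>z\<close> elements. The proportion of block sets containing a given
  \<open>T\<close> equals (s choose z) / ((N choose z) k^z), which accounts for the square;
  multiplying out avoids division of natural numbers.\<close>

lemma card_overlap:
  assumes "finite A" "k > 0" "S \<in> block_sets k A s" "z \<le> s" "s \<le> card A"
  shows "card {S' \<in> block_sets k A s. card (S \<inter> S') = z} * ((card A choose z) * k ^ z)
    \<le> (s choose z)\<^sup>2 * card (block_sets k A s)"
proof -
  let ?N = "card A"
  let ?F = "block_sets k A s"
  have S: "finite S" "card S = s" using assms(3) by (auto simp: block_sets_def)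
  define Z where "Z = {T. T \<subseteq> S \<and> card T = z}"
  have finZ: "finite Z" by (rule finite_subset[of _ "Pow S"]) (auto simp: Z_def S)
  have cardZ: "card Z = s choose z" unfolding Z_def using n_subsets[OF S(1)] S(2) by simp
  have sub: "{S' \<in> ?F. card (S \<inter> S') = z} \<subseteq> (\<Union>T\<in>Z. {S' \<in> ?F. T \<subseteq> S'})"
  proof clarify
    fix S' assume "S' \<in> ?F" "z = card (S \<inter> S')"
    then show "S' \<in> (\<Union>T\<in>Z. {S' \<in> ?F. T \<subseteq> S'})"
      by (intro UN_I[of "S \<inter> S'"]) (auto simp: Z_def)
  qed
  have "card {S' \<in> ?F. card (S \<inter> S') = z} \<le> card (\<Union>T\<in>Z. {S' \<in> ?F. T \<subseteq> S'})"
    by (rule card_mono[OF _ sub]) (use finZ finite_block_sets[OF assms(1,2)] in auto)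
  also have "\<dots> \<le> (\<Sum>T\<in>Z. card {S' \<in> ?F. T \<subseteq> S'})"
    by (rule card_UN_le[OF finZ])
  also have "\<dots> \<le> (\<Sum>T\<in>Z. ((?N - z) choose (s - z)) * k ^ (s - z))"
  proof (rule sum_mono)
    fix T assume "T \<in> Z"
    then have "T \<in> block_sets k A z"
      using assms(3) S by (auto simp: Z_def block_sets_def intro: inj_on_subset finite_subset)
    then show "card {S' \<in> ?F. T \<subseteq> S'} \<le> ((?N - z) choose (s - z)) * k ^ (s - z)"
      by (rule card_block_sets_superset[OF assms(1,2)])
  qed
  also have "\<dots> = (s choose z) * (((?N - z) choose (s - z)) * k ^ (s - z))"
    by (simp add: cardZ)
  finally have "card {S' \<in> ?F. card (S \<inter> S') = z} * ((?N choose z) * k ^ z)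
    \<le> (s choose z) * (((?N - z) choose (s - z)) * k ^ (s - z)) * ((?N choose z) * k ^ z)"
    by (rule mult_right_mono) simp
  also have "\<dots> = (s choose z) * ((?N choose z) * ((?N - z) choose (s - z))) * (k ^ (s - z) * k ^ z)"
    by (simp only: mult_ac)
  also have "(?N choose z) * ((?N - z) choose (s - z)) = (?N choose s) * (s choose z)"
    using choose_mult[OF assms(4,5)] by simp
  also have "k ^ (s - z) * k ^ z = k ^ s"
    using assms(4) by (simp add: power_add[symmetric])
  also have "(s choose z) * ((?N choose s) * (s choose z)) * k ^ s = (s choose z)\<^sup>2 * card ?F"
    using card_block_sets[OF assms(1,2)] by (simp add: power2_eq_square)
  finally show ?thesis .
qed

text \<open>The bound P(X > 0) \<ge> (E X)^2 / E X^2. Two sets with z common vertices have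
  \<open>z choose 2\<close> common pairs, and these must be absent only once; hence the correlation
  factor in \<open>overlap\<close>.\<close>

lemma second_moment:
  assumes V: "finite V" and F: "finite F" "F \<noteq> {}" "\<And>S. S \<in> F \<Longrightarrow> S \<subseteq> V \<and> card S = s"
    and p: "0 \<le> p" "p < 1" and "B > 0"
    and overlap: "\<And>S. S \<in> F \<Longrightarrow> (\<Sum>S'\<in>F. (1 / (1 - p)) ^ (card (S \<inter> S') choose 2)) \<le> B * real (card F)"
  shows "1 / B \<le> bexp (pairs V) (\<lambda>_. p) (\<lambda>E. of_bool (\<exists>S\<in>F. indep E S))"
proof -
  let ?B = "bexp (pairs V) (\<lambda>_. p)"
  define X where "X = (\<lambda>E. \<Sum>S\<in>F. of_bool (indep E S) :: real)"
  define m where "m = real (card F) * (1 - p) ^ (s choose 2)"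
  have m: "m > 0" using F p by (simp add: m_def card_gt_0_iff)
  have EX: "?B X = m"
    unfolding X_def bexp_sum m_def using F(3) V by (simp add: bexp_indep)
  have pair: "?B (\<lambda>E. of_bool (indep E S) * of_bool (indep E S'))
      = (1 - p) ^ (s choose 2) * (1 - p) ^ (s choose 2) * (1 / (1 - p)) ^ (card (S \<inter> S') choose 2)"
    if S: "S \<in> F" "S' \<in> F" for S S'
  proof -
    have fin: "finite S" "finite S'" using F(3) S V finite_subset by metis+
    have "?B (\<lambda>E. of_bool (indep E S) * of_bool (indep E S'))
       = ?B (\<lambda>E. of_bool (E \<inter> (pairs S \<union> pairs S') = {}))"
      by (rule bexp_cong) (auto simp: indep_iff)
    also have "\<dots> = (\<Prod>e\<in>pairs S \<union> pairs S'. 1 - p)"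
      by (rule bexp_avoid) (use V F(3) S in \<open>auto simp: pairs_def\<close>)
    also have "\<dots> = (1 - p) ^ card (pairs S \<union> pairs S')" by simp
    finally have 1: "?B (\<lambda>E. of_bool (indep E S) * of_bool (indep E S')) = (1 - p) ^ card (pairs S \<union> pairs S')" .
    have "pairs S \<inter> pairs S' = pairs (S \<inter> S')" by (auto simp: pairs_def)
    then have "card (pairs S \<union> pairs S') + (card (S \<inter> S') choose 2) = (s choose 2) + (s choose 2)"
      using card_Un_Int[of "pairs S" "pairs S'"] fin F(3) S by (simp add: card_pairs)
    then have "(1 - p) ^ card (pairs S \<union> pairs S') * (1 - p) ^ (card (S \<inter> S') choose 2)
       = (1 - p) ^ (s choose 2) * (1 - p) ^ (s choose 2)"
      by (metis power_add)
    then show ?thesis using 1 p by (simp add: power_divide field_simps)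
  qed
  have EX2: "?B (\<lambda>E. (X E)\<^sup>2) \<le> B * m\<^sup>2"
  proof -
    have "?B (\<lambda>E. (X E)\<^sup>2) = (\<Sum>S\<in>F. \<Sum>S'\<in>F. ?B (\<lambda>E. of_bool (indep E S) * of_bool (indep E S')))"
      unfolding X_def power2_eq_square sum_product bexp_sum ..
    also have "\<dots> = (\<Sum>S\<in>F. (1 - p) ^ (s choose 2) * (1 - p) ^ (s choose 2) * (\<Sum>S'\<in>F. (1 / (1 - p)) ^ (card (S \<inter> S') choose 2)))"
      unfolding sum_distrib_left by (intro sum.cong refl) (rule pair)
    also have "\<dots> \<le> (\<Sum>S\<in>F. (1 - p) ^ (s choose 2) * (1 - p) ^ (s choose 2) * (B * real (card F)))"
      by (intro sum_mono mult_left_mono overlap) (use p in auto)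
    also have "\<dots> = B * m\<^sup>2" by (simp add: m_def power2_eq_square)
    finally show ?thesis .
  qed
  \<comment> \<open>An indicator of \<open>X > 0\<close> dominates \<open>2 t X - t^2 X^2\<close>; this \<open>t\<close> is optimal.\<close>
  define t where "t = 1 / (B * m)"
  have "1 / B = 2 * t * m - t\<^sup>2 * (B * m\<^sup>2)"
    using m \<open>B > 0\<close> by (simp add: t_def power2_eq_square field_simps)
  also have "\<dots> \<le> 2 * t * ?B X - t\<^sup>2 * ?B (\<lambda>E. (X E)\<^sup>2)"
    using EX EX2 by (simp add: mult_left_mono)
  also have "\<dots> = ?B (\<lambda>E. 2 * t * X E - t\<^sup>2 * (X E)\<^sup>2)"
    by (simp only: bexp_diff bexp_cmult)
  also have "\<dots> \<le> ?B (\<lambda>E. of_bool (\<exists>S\<in>F. indep E S))"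
  proof (rule bexp_mono)
    fix E
    show "2 * t * X E - t\<^sup>2 * (X E)\<^sup>2 \<le> of_bool (\<exists>S\<in>F. indep E S)"
    proof (cases "\<exists>S\<in>F. indep E S")
      case True
      have "0 \<le> (1 - t * X E)\<^sup>2" by simp
      then show ?thesis using True by (simp add: power2_eq_square algebra_simps)
    next
      case False
      then have "X E = 0" by (simp add: X_def)
      then show ?thesis using False by simp
    qed
  qed (use p in auto)
  finally show ?thesis .
qed

section \<open>Factorials and binomial coefficients\<close>

lemma fact_ge_exp: "real z ^ z * exp (- real z) \<le> fact z"
proof (induction z)
  case (Suc z)
  show ?case
  proof (cases "z = 0")
    case False
    have "(1 + 1 / real z) ^ z \<le> exp 1"
      using exp_ge_one_plus_x_over_n_power_n[of z 1] False by simp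
    then have "((real z + 1) / real z) ^ z \<le> exp 1"
      using False by (simp add: add_divide_distrib)
    then have "(real z + 1) ^ z \<le> exp 1 * real z ^ z"
      using False by (simp add: power_divide divide_le_eq)
    then have "(real z + 1) * (real z + 1) ^ z * exp (- (real z + 1)) \<le> (real z + 1) * (exp 1 * real z ^ z) * exp (- (real z + 1))"
      by (intro mult_right_mono mult_left_mono) auto
    also have "\<dots> = (real z + 1) * (real z ^ z * exp (- real z))"
      by (simp add: exp_add exp_minus exp_diff field_simps)
    also have "\<dots> \<le> (real z + 1) * fact z"
      using Suc by (intro mult_left_mono) auto
    finally show ?thesis by (simp add: add.commute)
  qed simp
qed simp

text \<open>The bound e s (s/e)^s, written as one exponential because the overlap weights are
  compared through their exponents.\<close>

lemma fact_le_exp: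
  assumes "s > 0"
  shows "fact s \<le> exp (1 + ln (real s) + real s * ln (real s) - real s)"
  using assms
proof (induction s rule: nat_induct_non_zero)
  case 1
  then show ?case by simp
next
  case (Suc s)
  have "1 / (real s + 1) \<le> ln (real s + 1) - ln (real s)"
  proof -
    have "ln (real s / (real s + 1)) \<le> real s / (real s + 1) - 1"
      using Suc by (intro ln_le_minus_one) auto
    then show ?thesis using Suc by (simp add: ln_div field_simps)
  qed
  then have "1 \<le> (real s + 1) * (ln (real s + 1) - ln (real s))"
    using Suc by (simp add: divide_le_eq mult.commute)
  then have le: "ln (real s + 1) + (1 + ln (real s) + real s * ln (real s) - real s)
     \<le> 1 + ln (real s + 1) + (real s + 1) * ln (real s + 1) - (real s + 1)"
    by (simp add: algebra_simps)
  have "fact (Suc s) = (real s + 1) * fact s" by (simp add: algebra_simps)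
  also have "\<dots> \<le> (real s + 1) * exp (1 + ln (real s) + real s * ln (real s) - real s)"
    using Suc by (intro mult_left_mono) auto
  also have "\<dots> = exp (ln (real s + 1) + (1 + ln (real s) + real s * ln (real s) - real s))"
    by (simp add: exp_add exp_ln add_nonneg_pos)
  also have "\<dots> \<le> exp (1 + ln (real s + 1) + (real s + 1) * ln (real s + 1) - (real s + 1))"
    using le by simp
  finally show ?case by (simp add: add.commute)
qed

lemma choose_fact_le: "real (n choose k) * fact k \<le> real n ^ k"
  using of_nat_mono[OF binomial_fact_pow[of n k], where 'a = real] by simp

text \<open>The right side is a falling factorial whose \<open>z\<close> factors all exceed
  \<open>N - s\<close>.\<close>

lemma choose_fact_ge:
  assumes "z \<le> s" "s \<le> N"
  shows "real (N - s) ^ z \<le> real (N choose z) * fact z"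
  using assms(1)
proof (induction z)
  case (Suc z)
  have "real (N - s) ^ Suc z \<le> (real (N choose z) * fact z) * real (N - z)"
    unfolding power_Suc2 by (intro mult_mono Suc.IH) (use Suc assms in auto)
  also have "\<dots> = real (N choose Suc z) * fact (Suc z)"
  proof -
    have "Suc z * (N choose Suc z) = (N choose z) * (N - z)"
      by (metis binomial_absorb_comp binomial_absorption mult.commute)
    then have "real (Suc z) * real (N choose Suc z) = real (N choose z) * real (N - z)"
      by (metis of_nat_mult)
    moreover have "real (N choose Suc z) * fact (Suc z) = fact z * (real (Suc z) * real (N choose Suc z))"
      by (simp only: fact_Suc mult_ac)
    ultimately show ?thesis by (simp only: mult_ac)
  qed
  finally show ?case .
qed simp

section \<open>Overlap estimates\<close>

text \<open>By convexity the overlap exponents need checking only at the ends of an interval; this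
  is the source of most conditions in \<open>sparse\<close>.\<close>

lemma log_chord_nonpos:
  fixes r B C :: real
  assumes "0 \<le> r" "0 < l" "l \<le> w" "w \<le> u"
    and "- r * ln l + B * l + C \<le> 0" "- r * ln u + B * u + C \<le> 0"
  shows "- r * ln w + B * w + C \<le> 0"
proof -
  let ?f = "\<lambda>w. - r * ln w + B * w + C"
  have "convex_on {l..u} ?f"
  proof (rule convex_on_realI)
    fix z assume "z \<in> {l..u}"
    then show "(?f has_real_derivative (- r / z + B)) (at z)"
      using assms(2) by (auto intro!: derivative_eq_intros)
  next
    fix z y assume "z \<in> {l..u}" "y \<in> {l..u}" "z \<le> y"
    then show "- r / z + B \<le> - r / y + B"
      using assms(1,2) by (auto intro!: divide_left_mono)
  qed auto
  moreover have "w \<in> {l..u}" using assms by simp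
  ultimately have "?f w \<le> max (?f l) (?f u)"
    using assms by (intro convex_on_le_max) auto
  then show ?thesis using assms by simp
qed

text \<open>Here \<open>L\<close> stands for the logarithm of the inverse density of the sets, and \<open>gap d L\<close> is
  \<open>(1 + d)\<close> times the maximum of \<open>- 2 * w * ln w - w * L\<close>, the gain from overlaps of relative size \<open>1 - w\<close>.\<close>

definition gap :: "real \<Rightarrow> real \<Rightarrow> real" where
  "gap d L = (1 + d) * (2 * exp (-1)) * exp (- L / 2)"

text \<open>What the estimates below ask of a large \<open>L\<close>. The first two lines check the
  moderate overlap exponent at y = exp (2 - L) and y = 1/2. The third, together with the second,
  checks the large overlap exponent for w between exp (- 2L/5) and 1/2. The last says that for
  smaller w the perturbation of the maximum fits into the factor \<open>1 + d\<close> of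
  \<open>gap\<close>.\<close>

definition sparse :: "real \<Rightarrow> real \<Rightarrow> bool" where
  "sparse d L \<longleftrightarrow>
     - 1 + (L + 1) * exp (2 - L) \<le> 0 \<and>
     1 + ln 2 - L + (L + 1) / 2 \<le> 0 \<and>
     - (L / 5) + (L + 1) * exp (- (2 * L / 5)) \<le> 0 \<and>
     exp (((L + 1) * exp (- (2 * L / 5)) + 2 * gap d L) / 2) \<le> 1 + d"

lemma eventually_sparse: "d > 0 \<Longrightarrow> eventually (sparse d) at_top"
  unfolding sparse_def gap_def by (intro eventually_conj) real_asymp+

lemma gap_nonneg: "d > 0 \<Longrightarrow> 0 \<le> gap d L"
  by (simp add: gap_def)

text \<open>Here y is z / s. The counting part 1 - ln y - L is positive until y reaches exp (1 - L);
  starting at exp (2 - L) leaves room 1 for the correlation term A y.\<close>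

lemma moderate_overlap_exponent:
  assumes "sparse d L" "A \<le> L + 1" "exp (2 - L) \<le> y" "y \<le> 1/2"
  shows "1 - ln y - L + A * y \<le> 0"
proof -
  have y: "y > 0" using assms(3) exp_gt_zero[of "2 - L"] by linarith
  have "- 1 * ln y + (L + 1) * y + (1 - L) \<le> 0"
  proof (rule log_chord_nonpos)
    show "- 1 * ln (exp (2 - L)) + (L + 1) * exp (2 - L) + (1 - L) \<le> 0"
      using assms(1) by (simp add: sparse_def)
    show "- 1 * ln (1/2) + (L + 1) * (1/2) + (1 - L) \<le> 0"
      using assms(1) by (simp add: sparse_def ln_div)
  qed (use assms in auto)
  moreover have "A * y \<le> (L + 1) * y" using assms(2) y by (intro mult_right_mono) auto
  ultimately show ?thesis by simp
qed

text \<open>The right side is the maximum over w, attained at w = exp (- 1 - r); this is where the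
  constant 1/e in the loss arises.\<close>

lemma mult_ln_le:
  fixes w r :: real
  assumes "w > 0"
  shows "w * (- ln w - r) \<le> exp (- 1 - r)"
proof -
  have "ln (exp (- 1 - r) / w) \<le> exp (- 1 - r) / w - 1"
    using assms by (intro ln_le_minus_one) simp
  then have "- ln w - r \<le> exp (- 1 - r) / w"
    using assms by (simp add: ln_div)
  then show ?thesis using assms by (simp add: le_divide_eq mult.commute)
qed

text \<open>For A = L + 1 - gap everything of order 1 cancels and w (- 2 ln w + (L + 1) w - L) - (1
  - w)^2 gap remains. For small w the first summand has maximum close to 2 exp (- 1 - L/2), which
  \<open>gap\<close> was defined to compensate; for the other w it is not even positive.\<close>

lemma large_overlap_exponent:
  assumes "sparse d L" "d > 0" "A \<le> L + 1 - gap d L" "0 < w" "w \<le> 1/2"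
  shows "2 * w - 2 * w * ln w - 1 - (1 - w) * L + (1 - w)\<^sup>2 * A \<le> 0"
proof -
  define g where "g = gap d L"
  \<comment> \<open>Any constant between 0 and 1/2 could replace 2/5: below 1/2 the term - 2 ln u
    stays under L, and a positive one makes (L + 1) u tend to 0.\<close>
  define u where "u = exp (- (2 * L / 5))"
  have g0: "0 \<le> g" using assms(2) by (simp add: g_def gap_nonneg)
  have s: "1 + ln 2 - L + (L + 1) / 2 \<le> 0" "- (L / 5) + (L + 1) * u \<le> 0"
    "exp (((L + 1) * u + 2 * g) / 2) \<le> 1 + d"
    using assms(1) by (simp_all add: sparse_def u_def g_def)
  have "(1 - w)\<^sup>2 * A \<le> (1 - w)\<^sup>2 * (L + 1 - g)"
    using assms(3) by (intro mult_left_mono) (auto simp: g_def)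
  then have "2 * w - 2 * w * ln w - 1 - (1 - w) * L + (1 - w)\<^sup>2 * A
     \<le> 2 * w - 2 * w * ln w - 1 - (1 - w) * L + (1 - w)\<^sup>2 * (L + 1 - g)" by simp
  also have "\<dots> = w * (- 2 * ln w + (L + 1) * w - L) - (1 - w)\<^sup>2 * g"
    by (simp add: power2_eq_square algebra_simps)
  finally have T: "2 * w - 2 * w * ln w - 1 - (1 - w) * L + (1 - w)\<^sup>2 * A
     \<le> w * (- 2 * ln w + (L + 1) * w - L) - (1 - w)\<^sup>2 * g" .
  have L_ge: "L \<ge> 1" if "0 < q" "1 + q - L + (L + 1) / 2 \<le> 0" for q :: real
    using that by (simp add: field_simps)
  have L3: "L \<ge> 1" by (rule L_ge[OF _ s(1)]) simp
  show ?thesis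
  proof (cases "w \<le> u")
    case True
    \<comment> \<open>Collects both perturbations of the slope in w: (L + 1) w is at most (L + 1) u,
      and 2 g comes from (1 - w)^2 \<ge> 1 - 2 w.\<close>
    define t where "t = (L + 1) * u + 2 * g"
    have "(L + 1) * w \<le> (L + 1) * u" using True L3 by (intro mult_left_mono) auto
    then have "w * (- 2 * ln w + (L + 1) * w - L) \<le> w * (- 2 * ln w + (L + 1) * u - L)"
      using assms(4) by (intro mult_left_mono) auto
    moreover have "(1 - w)\<^sup>2 * g \<ge> (1 - 2 * w) * g"
      using g0 by (intro mult_right_mono) (auto simp: power2_eq_square algebra_simps)
    ultimately have "w * (- 2 * ln w + (L + 1) * w - L) - (1 - w)\<^sup>2 * g
       \<le> 2 * (w * (- ln w - (L - t) / 2)) - g"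
      by (simp add: t_def field_simps)
    also have "\<dots> \<le> 2 * exp (- 1 - (L - t) / 2) - g"
      using mult_ln_le[OF assms(4), of "(L - t) / 2"] by simp
    also have "2 * exp (- 1 - (L - t) / 2) = 2 * exp (-1) * exp (- L / 2) * exp (t / 2)"
      by (simp add: exp_add[symmetric] field_simps)
    also have "\<dots> \<le> 2 * exp (-1) * exp (- L / 2) * (1 + d)"
      using s(3) by (intro mult_left_mono) (auto simp: t_def)
    also have "\<dots> - g = 0" by (simp add: g_def gap_def)
    finally show ?thesis using T by simp
  next
    case False
    have "- 2 * ln w + (L + 1) * w + - L \<le> 0"
    proof (rule log_chord_nonpos)
      show "- 2 * ln u + (L + 1) * u + - L \<le> 0" using s(2) by (simp add: u_def)
      show "- 2 * ln (1/2) + (L + 1) * (1/2) + - L \<le> 0"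
        using s(1) ln_2_less_1 by (simp add: ln_div)
    qed (use False assms in \<open>auto simp: u_def\<close>)
    then have "w * (- 2 * ln w + (L + 1) * w - L) \<le> 0"
      using assms(4) by (simp add: mult_nonneg_nonpos)
    moreover have "0 \<le> (1 - w)\<^sup>2 * g" using g0 by simp
    ultimately show ?thesis using T by simp
  qed
qed

section \<open>Weights of the overlap classes\<close>

lemma inverse_fact_le_exp:
  assumes "m > 0"
  shows "1 / fact m \<le> exp (real m - real m * ln (real m))"
proof -
  have "exp (real m * ln (real m) - real m) = real m ^ m * exp (- real m)"
    using assms by (simp add: exp_diff exp_minus exp_of_nat_mult field_simps)
  also have "\<dots> \<le> fact m" by (rule fact_ge_exp)
  finally have "1 / fact m \<le> 1 / exp (real m * ln (real m) - real m)"
    by (intro divide_left_mono) auto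
  also have "\<dots> = exp (real m - real m * ln (real m))"
    by (simp add: exp_diff)
  finally show ?thesis .
qed

lemma choose_le_exp:
  assumes "m > 0" "s > 0"
  shows "real (s choose m) \<le> exp (real m * (1 + ln (real s) - ln (real m)))"
proof -
  have "real (s choose m) \<le> real s ^ m * (1 / fact m)"
    using choose_fact_le[of s m] by (simp add: le_divide_eq)
  also have "\<dots> \<le> real s ^ m * exp (real m - real m * ln (real m))"
    by (intro mult_left_mono inverse_fact_le_exp assms) auto
  also have "real s ^ m = exp (real m * ln (real s))"
    using assms by (simp add: exp_of_nat_mult)
  finally show ?thesis by (simp add: exp_add[symmetric] algebra_simps)
qed

text \<open>The product bounds the proportion of sets with overlap z, times their correlation
  factor. One of the two binomials absorbs \<open>fact z\<close>, and the other is at most (e s /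
  z)^z.\<close>

lemma moderate_overlap_weight:
  assumes "sparse d L" "A \<le> L + 1" "s > 0" and D: "D = real s * exp L"
    and z: "exp (2 - L) * real s < real z" "real z \<le> real s / 2"
  shows "(real (s choose z))\<^sup>2 * fact z / D ^ z * exp (A * (real z)\<^sup>2 / real s) \<le> 1"
proof -
  have D0: "D > 0" using D assms(3) by simp
  have "0 < exp (2 - L) * real s" using assms(3) by simp
  then have z0: "z > 0" using z(1) by linarith
  define y where "y = real z / real s"
  have y: "exp (2 - L) \<le> y" "y \<le> 1/2" "real z = y * real s" "y > 0"
    using z assms(3) z0 by (auto simp: y_def field_simps)
  have "(real (s choose z))\<^sup>2 * fact z / D ^ z = real (s choose z) * (real (s choose z) * fact z) / D ^ z"
    by (simp add: power2_eq_square)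
  also have "\<dots> \<le> exp (real z * (1 + ln (real s) - ln (real z))) * real s ^ z / D ^ z"
    using D0 by (intro divide_right_mono mult_mono choose_le_exp choose_fact_le assms z0) auto
  also have "\<dots> = exp (real z * (1 + ln (real s) - ln (real z))) * exp (- L * real z)"
    using assms(3) by (simp add: D power_mult_distrib exp_of_nat_mult[symmetric] exp_minus field_simps)
  also have "\<dots> = exp (real z * (1 - ln y - L))"
    using assms(3) z0 by (simp add: exp_add[symmetric] y_def ln_div algebra_simps)
  finally have "(real (s choose z))\<^sup>2 * fact z / D ^ z * exp (A * (real z)\<^sup>2 / real s)
    \<le> exp (real z * (1 - ln y - L)) * exp (A * (real z)\<^sup>2 / real s)"
    by (intro mult_right_mono) auto
  also have "\<dots> = exp (real z * (1 - ln y - L + A * y))"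
    using assms(3) by (simp add: exp_add[symmetric] y_def power2_eq_square algebra_simps)
  also have "\<dots> \<le> 1"
    using moderate_overlap_exponent[OF assms(1,2) y(1,2)] by (simp add: mult_nonneg_nonpos)
  finally show ?thesis .
qed

text \<open>Near full overlap the estimates must be sharp in the number m = s - z of vertices that
  differ, so the binomials are rewritten as (s choose m) s! / m!. Bounding s! by Stirling costs the
  factor e s.\<close>

lemma large_overlap_weight:
  assumes "sparse d L" "d > 0" "A \<le> L + 1 - gap d L" "s > 0" and D: "D = real s * exp L"
    and z: "real s / 2 < real z" "z \<le> s"
  shows "(real (s choose z))\<^sup>2 * fact z / D ^ z * exp (A * (real z)\<^sup>2 / real s) \<le> exp 1 * real s"
proof -
  define S where "S = real s"
  have S: "S > 0" using assms(4) by (simp add: S_def)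
  have s_fact: "fact s \<le> exp (1 + ln S + S * ln S - S)"
    using fact_le_exp[OF assms(4)] by (simp add: S_def)
  have Dz: "1 / D ^ z = exp (- real z * (ln S + L))"
  proof -
    have "D = exp (ln S + L)" using S by (simp add: D S_def exp_add)
    then have "D ^ z = exp (real z * (ln S + L))" by (simp add: exp_of_nat_mult)
    then show ?thesis by (simp add: exp_minus inverse_eq_divide)
  qed
  have eS: "exp 1 * S = exp (1 + ln S)" using S by (simp add: exp_add)
  show ?thesis
  \<comment> \<open>Full overlap is separate because ln m is used below. It needs A \<le> L + 1,
    which is the first moment condition.\<close>
  proof (cases "z = s")
    case True
    have "(real (s choose z))\<^sup>2 * fact z / D ^ z * exp (A * (real z)\<^sup>2 / real s)
       = fact s * (1 / D ^ z) * exp (A * S)"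
      using True S by (simp add: S_def power2_eq_square)
    also have "\<dots> \<le> exp (1 + ln S + S * ln S - S) * exp (- real z * (ln S + L)) * exp (A * S)"
      unfolding Dz by (intro mult_right_mono s_fact) auto
    also have "\<dots> = exp (1 + ln S + S * (A - L - 1))"
      using True by (simp add: exp_add[symmetric] S_def algebra_simps)
    also have "\<dots> \<le> exp (1 + ln S)"
      using assms(2,3) gap_nonneg[of d L] S by (simp add: mult_nonneg_nonpos)
    finally show ?thesis using eS by (simp add: S_def)
  next
    case False
    define m where "m = s - z"
    define w where "w = real m / S"
    have m: "m > 0" "real m = S - real z" "m \<le> s" using False z(2) by (auto simp: m_def S_def)
    have mw: "real m = w * S" using S by (simp add: w_def)
    have "real m \<le> S / 2" using m(2) z(1) by (simp add: S_def)
    then have "w * S \<le> 1 / 2 * S" by (simp add: mw)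
    then have w2: "w \<le> 1 / 2" using S by (rule mult_right_le_imp_le)
    have w4: "real z = (1 - w) * S" unfolding left_diff_distrib mw[symmetric] using m(2) by simp
    have "0 < w" using m(1) S by (simp add: w_def)
    note w = this w2 mw w4
    have "(real (s choose z))\<^sup>2 * fact z = real (s choose m) * (fact s * (1 / fact m))"
    proof -
      have "fact z * fact m * real (s choose z) = fact s"
        using arg_cong[OF binomial_fact_lemma[OF z(2)], of real] by (simp add: m_def)
      moreover have "s choose m = s choose z" using binomial_symmetric[OF z(2)] by (simp add: m_def)
      ultimately show ?thesis by (simp add: power2_eq_square field_simps)
    qed
    then have "(real (s choose z))\<^sup>2 * fact z / D ^ z * exp (A * (real z)\<^sup>2 / real s)
      = real (s choose m) * (fact s * (1 / fact m)) * (1 / D ^ z) * exp (A * (real z)\<^sup>2 / real s)"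
      by simp
    also have "\<dots> \<le> exp (real m * (1 + ln (real s) - ln (real m))) *
       (exp (1 + ln S + S * ln S - S) * exp (real m - real m * ln (real m))) *
       exp (- real z * (ln S + L)) * exp (A * (real z)\<^sup>2 / real s)"
      unfolding Dz
      by (intro mult_right_mono mult_mono choose_le_exp s_fact inverse_fact_le_exp m assms(4)) auto
    also have "\<dots> = exp (1 + ln S + S * (2 * w - 2 * w * ln w - 1 - (1 - w) * L + (1 - w)\<^sup>2 * A))"
    proof -
      have lnm: "ln (real m) = ln w + ln S" using w S by (simp add: ln_mult)
      have "A * (real z)\<^sup>2 / real s = S * ((1 - w)\<^sup>2 * A)"
        using S w(4) by (simp add: S_def[symmetric] power2_eq_square)
      then show ?thesis
        unfolding lnm S_def[symmetric] unfolding w(3,4) exp_add[symmetric]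
        by (simp add: algebra_simps)
    qed
    also have "\<dots> \<le> exp (1 + ln S)"
      using large_overlap_exponent[OF assms(1,2,3) w(1,2)] S by (simp add: mult_nonneg_nonpos)
    finally show ?thesis using eS by (simp add: S_def)
  qed
qed

text \<open>The overlap sizes are cut at exp (2 - L) s and s / 2. Up to the first cut the number of
  sets is bounded trivially and the correlation by
  \<open>exp (real s * A * exp (4 - 2 * L))\<close>, the only exponential loss; each of the other
  classes weighs at most 3 s, with 3 bounding e.\<close>

lemma overlap_sum_le:
  assumes "k > 0" "s > 0" "s < N" "0 \<le> p" "p < 1" "d > 0"
    and L: "L = ln (real (N - s) * real k / real s)" and A: "A = real s * (- ln (1 - p)) / 2"
    and sparse: "sparse d L" and A_le: "A \<le> L + 1 - gap d L"
    and S: "S \<in> block_sets k {..<N} s"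
  shows "(\<Sum>S'\<in>block_sets k {..<N} s. (1 / (1 - p)) ^ (card (S \<inter> S') choose 2))
    \<le> 3 * real s * (real s + 1) * exp (real s * A * exp (4 - 2 * L)) * real (card (block_sets k {..<N} s))"
proof -
  let ?F = "block_sets k {..<N} s"
  let ?M = "real (card ?F)"
  define D where "D = real (N - s) * real k"
  have D0: "D > 0" using assms(1,3) by (simp add: D_def)
  have "exp L = D / real s" unfolding L D_def[symmetric] by (rule exp_ln) (use D0 assms(2) in simp)
  then have D: "D = real s * exp L" using assms(2) by simp
  define Y where "Y = real s * A * exp (4 - 2 * L)"
  have r0: "0 \<le> - ln (1 - p)" using assms(4,5) by simp
  have A0: "0 \<le> A" unfolding A using r0 by (intro divide_nonneg_nonneg mult_nonneg_nonneg) auto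
  have Y0: "0 \<le> Y" using A0 by (simp add: Y_def)
  have finF: "finite ?F" using assms(1) by (intro finite_block_sets) auto
  have finS: "finite S" "card S = s" using S by (auto simp: block_sets_def)
  define g where "g = (\<lambda>z. (1 / (1 - p)) ^ (z choose 2))"
  define n where "n = (\<lambda>z. card {S' \<in> ?F. card (S \<inter> S') = z})"
  have g: "g z \<le> exp (A * (real z)\<^sup>2 / real s)" for z
  proof -
    have "1 / (1 - p) = exp (- ln (1 - p))" using assms(5) by (simp add: exp_minus inverse_eq_divide)
    then have "g z = exp (real (z choose 2) * (- ln (1 - p)))"
      unfolding g_def by (simp only: exp_of_nat_mult)
    also have "\<dots> \<le> exp ((real z)\<^sup>2 / 2 * (- ln (1 - p)))"
    proof -
      have "real (z choose 2) \<le> (real z)\<^sup>2 / 2"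
        unfolding real_choose_two by (simp add: power2_eq_square algebra_simps)
      then show ?thesis using mult_right_mono[OF _ r0] by (simp only: exp_le_cancel_iff)
    qed
    also have "(real z)\<^sup>2 / 2 * (- ln (1 - p)) = A * (real z)\<^sup>2 / real s"
      using assms(2) by (simp add: A)
    finally show ?thesis .
  qed
  have part: "real (n z) * g z \<le> ?M * (3 * real s * exp Y)" if "z \<le> s" for z
  proof (cases "real z \<le> exp (2 - L) * real s")
    case True
    have "(real z)\<^sup>2 \<le> (exp (2 - L) * real s)\<^sup>2" using True by (intro power_mono) auto
    also have "\<dots> = exp (4 - 2 * L) * (real s)\<^sup>2"
      unfolding power_mult_distrib by (simp add: power2_eq_square[of "exp _"] exp_add[symmetric])
    finally have "A * (real z)\<^sup>2 / real s \<le> A * (exp (4 - 2 * L) * (real s)\<^sup>2) / real s"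
      using A0 by (intro divide_right_mono mult_left_mono) auto
    also have "\<dots> = Y" using assms(2) by (simp add: Y_def power2_eq_square)
    finally have "g z \<le> exp Y" using g[of z] by (meson exp_le_cancel_iff order_trans)
    moreover have "real (n z) \<le> ?M" unfolding n_def using finF by (intro of_nat_mono card_mono) auto
    ultimately have "real (n z) * g z \<le> ?M * exp Y"
      using assms(5) by (intro mult_mono) (auto simp: g_def)
    also have "\<dots> \<le> ?M * (3 * real s * exp Y)" using assms(2) by (intro mult_left_mono) auto
    finally show ?thesis .
  next
    case False
    have "real (n z) * (real (N choose z) * real k ^ z) \<le> (real (s choose z))\<^sup>2 * ?M"
      using of_nat_mono[OF card_overlap[OF finite_lessThan assms(1) S that], where 'a = real] assms(3)
      by (simp add: n_def)
    moreover have "D ^ z \<le> real (N choose z) * real k ^ z * fact z"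
      using mult_right_mono[OF choose_fact_ge[OF that, of N], of "real k ^ z"] assms(3)
      by (simp add: D_def power_mult_distrib mult_ac)
    ultimately have "real (n z) * D ^ z \<le> (real (s choose z))\<^sup>2 * fact z * ?M"
    proof -
      assume a: "real (n z) * (real (N choose z) * real k ^ z) \<le> (real (s choose z))\<^sup>2 * ?M"
        and b: "D ^ z \<le> real (N choose z) * real k ^ z * fact z"
      have "real (n z) * D ^ z \<le> real (n z) * (real (N choose z) * real k ^ z * fact z)"
        by (intro mult_left_mono b) auto
      also have "\<dots> = real (n z) * (real (N choose z) * real k ^ z) * fact z" by simp
      also have "\<dots> \<le> (real (s choose z))\<^sup>2 * ?M * fact z" by (intro mult_right_mono a) auto
      finally show ?thesis by (simp add: mult_ac)
    qed
    then have nz: "real (n z) \<le> ?M * ((real (s choose z))\<^sup>2 * fact z / D ^ z)"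
      using D0 by (simp add: le_divide_eq mult_ac)
    have weight: "(real (s choose z))\<^sup>2 * fact z / D ^ z * exp (A * (real z)\<^sup>2 / real s) \<le> 3 * real s"
    proof (cases "real z \<le> real s / 2")
      case True
      have "(real (s choose z))\<^sup>2 * fact z / D ^ z * exp (A * (real z)\<^sup>2 / real s) \<le> 1"
        by (rule moderate_overlap_weight[OF sparse _ assms(2) D])
          (use A_le gap_nonneg[OF assms(6), of L] False True in auto)
      then show ?thesis using assms(2) by linarith
    next
      case z: False
      have "(real (s choose z))\<^sup>2 * fact z / D ^ z * exp (A * (real z)\<^sup>2 / real s) \<le> exp 1 * real s"
        by (rule large_overlap_weight[OF sparse assms(6) A_le assms(2) D]) (use z that in auto)
      also have "\<dots> \<le> 3 * real s" using exp_le by (intro mult_right_mono) auto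
      finally show ?thesis .
    qed
    have "real (n z) * g z \<le> ?M * ((real (s choose z))\<^sup>2 * fact z / D ^ z) * exp (A * (real z)\<^sup>2 / real s)"
      using D0 assms(5) by (intro mult_mono nz g) (auto simp: g_def)
    also have "\<dots> = ?M * ((real (s choose z))\<^sup>2 * fact z / D ^ z * exp (A * (real z)\<^sup>2 / real s))"
      by simp
    also have "\<dots> \<le> ?M * (3 * real s)" by (intro mult_left_mono weight) auto
    also have "\<dots> \<le> ?M * (3 * real s * exp Y)"
      using Y0 assms(2) by (intro mult_left_mono) auto
    finally show ?thesis .
  qed
  have "(\<Sum>S'\<in>?F. g (card (S \<inter> S'))) = (\<Sum>z\<in>{..s}. \<Sum>S'\<in>{S' \<in> ?F. card (S \<inter> S') = z}. g (card (S \<inter> S')))"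
    by (rule sum.group[symmetric]) (use finF finS in \<open>auto intro: card_mono\<close>)
  also have "\<dots> = (\<Sum>z\<in>{..s}. real (n z) * g z)"
    by (intro sum.cong refl) (simp add: n_def)
  also have "\<dots> \<le> (\<Sum>z\<in>{..s}. ?M * (3 * real s * exp Y))"
    by (intro sum_mono part) simp
  also have "\<dots> = 3 * real s * (real s + 1) * exp Y * ?M" by simp
  finally show ?thesis by (simp add: g_def Y_def)
qed

section \<open>The lower bound\<close>

lemma alpha_block_lower:
  assumes "k > 0" "s > 0" "s < n div k" "0 \<le> p" "p < 1" "d > 0"
    and L: "L = ln (real (n div k - s) * real k / real s)" and A: "A = real s * (- ln (1 - p)) / 2"
    and sparse: "sparse d L" and A_le: "A \<le> L + 1 - gap d L"
  shows "1 / (3 * real s * (real s + 1) * exp (real s * A * exp (4 - 2 * L)))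
    \<le> bexp (pairs {..<n}) (\<lambda>_. p) (\<lambda>E. of_bool (s \<le> alpha (\<lambda>v. v div k) {..<n} E))"
proof -
  let ?F = "block_sets k {..<n div k} s"
  let ?b = "\<lambda>v. v div k"
  have "card ?F = (n div k choose s) * k ^ s" using assms(1) by (simp add: card_block_sets)
  then have "card ?F > 0" using assms by (simp add: zero_less_binomial_iff)
  then have F: "finite ?F" "?F \<noteq> {}" by (auto simp: card_gt_0_iff)
  have sub: "S \<subseteq> {..<n}" if "S \<in> ?F" for S
  proof
    fix v assume "v \<in> S"
    then have "v div k < n div k" using that by (auto simp: block_sets_def)
    then show "v \<in> {..<n}" by (metis div_le_mono lessThan_iff not_le)
  qed
  have "1 / (3 * real s * (real s + 1) * exp (real s * A * exp (4 - 2 * L)))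
    \<le> bexp (pairs {..<n}) (\<lambda>_. p) (\<lambda>E. of_bool (\<exists>S\<in>?F. indep E S))"
  proof (rule second_moment[OF _ F, where s = s])
    fix S assume S: "S \<in> ?F"
    show "S \<subseteq> {..<n} \<and> card S = s" using S sub by (auto simp: block_sets_def)
    show "(\<Sum>S'\<in>?F. (1 / (1 - p)) ^ (card (S \<inter> S') choose 2))
      \<le> 3 * real s * (real s + 1) * exp (real s * A * exp (4 - 2 * L)) * real (card ?F)"
      by (rule overlap_sum_le[OF assms S])
  qed (use assms in auto)
  also have "\<dots> \<le> bexp (pairs {..<n}) (\<lambda>_. p) (\<lambda>E. of_bool (s \<le> alpha ?b {..<n} E))"
  proof (rule bexp_mono)
    fix E
    have "s \<le> alpha ?b {..<n} E" if "S \<in> ?F" "indep E S" for S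
    proof -
      have "S \<in> indep_sets ?b {..<n} E" "card S = s"
        using that sub[of S] by (auto simp: indep_sets_def block_sets_def)
      then show ?thesis using card_le_alpha[of "{..<n}" S ?b E] by simp
    qed
    then show "(of_bool (\<exists>S\<in>?F. indep E S) :: real) \<le> of_bool (s \<le> alpha ?b {..<n} E)" by auto
  qed (use assms in auto)
  finally show ?thesis .
qed

text \<open>If the mean for block sets lies t below \<open>s\<close>, reaching \<open>s\<close> is a
  deviation by t and has probability at most exp (- t^2 / (4 (n div k + 1))). The second moment
  bounds the same probability from below, so t cannot exceed the square root.\<close>

lemma mean_alpha_lower:
  assumes "k > 0" "s > 0" "s < n div k" "0 \<le> p" "p < 1" "d > 0"
    and L: "L = ln (real (n div k - s) * real k / real s)" and A: "A = real s * (- ln (1 - p)) / 2"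
    and sparse: "sparse d L" and A_le: "A \<le> L + 1 - gap d L"
  shows "real s - sqrt (4 * (real (n div k) + 1) * (real s * A * exp (4 - 2 * L) + 2 * ln (real n + 1) + ln 3))
    \<le> mean_alpha {..<n} p"
proof -
  let ?b = "\<lambda>v. v div k"
  let ?B = "bexp (pairs {..<n}) (\<lambda>_. p)"
  let ?Y = "real s * A * exp (4 - 2 * L)"
  let ?R = "4 * (real (n div k) + 1) * (?Y + 2 * ln (real n + 1) + ln 3)"
  define m where "m = ?B (\<lambda>E. real (alpha ?b {..<n} E))"
  have "s < n" using assms(3) div_le_dividend[of n k] by linarith
  have "alpha ?b {..<n} E \<le> alpha id {..<n} E" for E
  proof -
    obtain S where "S \<in> indep_sets ?b {..<n} E" "card S = alpha ?b {..<n} E"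
      by (rule alpha_attained[of "{..<n}" ?b E]) auto
    moreover from this have "S \<in> indep_sets id {..<n} E" by (simp add: indep_sets_def)
    ultimately show ?thesis using card_le_alpha[of "{..<n}" S id E] by simp
  qed
  then have m_le: "m \<le> mean_alpha {..<n} p"
    unfolding m_def mean_alpha_def by (intro bexp_mono) (use assms in auto)
  have m0: "0 \<le> m"
    unfolding m_def
    by (rule bexp_bounds[where u = "real n"]) (use assms alpha_le_card[of "{..<n}"] in auto)
  have A0: "0 \<le> A"
    unfolding A using assms(4,5) by (intro divide_nonneg_nonneg mult_nonneg_nonneg) auto
  have R0: "0 \<le> ?R" using A0 by (intro mult_nonneg_nonneg add_nonneg_nonneg) auto
  have "real s - m \<le> sqrt ?R"
  proof (cases "real s \<le> m")
    case True
    then show ?thesis using R0 real_sqrt_ge_zero[OF R0] by linarith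
  next
    case False
    have exp_eq: "exp (y + 2 * ln q + ln 3) = 3 * q * q * exp y" if "q > 0" for q y :: real
      unfolding mult_2[of "ln q"] exp_add using that by simp
    define t where "t = real s - m"
    \<comment> \<open>The number of labels is \<open>n div k + 1\<close>, since an incomplete last
      block has a label too.\<close>
    have t: "0 \<le> t" "t \<le> 2 * real (n div k + 1)"
      using False m0 assms(3) by (auto simp: t_def)
    have "1 / (3 * real s * (real s + 1) * exp ?Y) \<le> ?B (\<lambda>E. of_bool (s \<le> alpha ?b {..<n} E))"
      by (rule alpha_block_lower[OF assms])
    also have "\<dots> = ?B (\<lambda>E. of_bool (real (alpha ?b {..<n} E) \<ge> m + t))"
      by (simp add: t_def)
    also have "\<dots> \<le> exp (- (t\<^sup>2 / (4 * real (n div k + 1))))"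
      unfolding m_def
      by (rule alpha_upper_tail) (use t assms in \<open>auto simp: m_def div_le_mono less_Suc_eq_le\<close>)
    finally have inv: "inverse (3 * real s * (real s + 1) * exp ?Y) \<le> inverse (exp (t\<^sup>2 / (4 * real (n div k + 1))))"
      by (simp only: exp_minus inverse_eq_divide)
    have "exp (t\<^sup>2 / (4 * real (n div k + 1))) \<le> 3 * real s * (real s + 1) * exp ?Y"
      by (rule inverse_le_imp_le[OF inv]) (use assms(2) in simp)
    also have "\<dots> \<le> 3 * (real n + 1) * (real n + 1) * exp ?Y"
      using \<open>s < n\<close> by (intro mult_right_mono mult_mono) auto
    also have "\<dots> = exp (?Y + 2 * ln (real n + 1) + ln 3)"
      by (rule exp_eq[symmetric]) simp
    finally have "t\<^sup>2 / (4 * real (n div k + 1)) \<le> ?Y + 2 * ln (real n + 1) + ln 3"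
      by (simp only: exp_le_cancel_iff)
    then have "t\<^sup>2 \<le> ?R"
      by (subst (asm) divide_le_eq) (simp_all add: algebra_simps)
    then show ?thesis using real_le_rsqrt[of t ?R] by (simp add: t_def)
  qed
  then show ?thesis using m_le by linarith
qed

section \<open>Passage to the limit in n\<close>

lemma tendsto_div_nat:
  assumes "k > 0"
  shows "(\<lambda>n. real (n div k) / real n) \<longlonglongrightarrow> 1 / real k"
proof (rule tendsto_sandwich)
  have k: "real k > 0" using assms by simp
  show "\<forall>\<^sub>F n in sequentially. 1 / real k - 1 / real n \<le> real (n div k) / real n"
    using eventually_gt_at_top[of 0]
  proof eventually_elim
    case (elim n)
    have "real n / real k - 1 \<le> real (n div k)"
      using floor_divide_of_nat_eq[of n k, where ?'a = real] by linarith
    then have "(real n / real k - 1) / real n \<le> real (n div k) / real n"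
      by (intro divide_right_mono) auto
    then show ?case using elim by (simp add: diff_divide_distrib)
  qed
  show "\<forall>\<^sub>F n in sequentially. real (n div k) / real n \<le> 1 / real k"
    using eventually_gt_at_top[of 0]
  proof eventually_elim
    case (elim n)
    have "real (n div k) / real n \<le> (real n / real k) / real n"
      using floor_divide_of_nat_eq[of n k, where ?'a = real] by (intro divide_right_mono) linarith+
    then show ?case using elim by simp
  qed
  show "(\<lambda>n. 1 / real k - 1 / real n) \<longlonglongrightarrow> 1 / real k" by real_asymp
qed simp

lemma tendsto_ceiling_ratio:
  assumes "b > 0"
  shows "(\<lambda>n. real (nat \<lceil>b * real n\<rceil>) / real n) \<longlonglongrightarrow> b"
proof (rule tendsto_sandwich)
  show "\<forall>\<^sub>F n in sequentially. b \<le> real (nat \<lceil>b * real n\<rceil>) / real n"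
    using eventually_gt_at_top[of 0]
  proof eventually_elim
    case (elim n)
    have "b * real n \<le> real (nat \<lceil>b * real n\<rceil>)" by linarith
    then show ?case using elim by (simp add: le_divide_eq)
  qed
  show "\<forall>\<^sub>F n in sequentially. real (nat \<lceil>b * real n\<rceil>) / real n \<le> b + 1 / real n"
    using eventually_gt_at_top[of 0]
  proof eventually_elim
    case (elim n)
    have "0 \<le> b * real n" using assms by simp
    then have "real (nat \<lceil>b * real n\<rceil>) \<le> b * real n + 1" by linarith
    then show ?case using elim by (simp add: field_simps)
  qed
  show "(\<lambda>n. b + 1 / real n) \<longlonglongrightarrow> b" by real_asymp
qed simp

text \<open>The previous bound divided by n, for sets of size b n: \<open>A\<close> tends to b c /
  2, \<open>L\<close> to \<open>l\<close>, and the polynomial factors disappear. The assumptions on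
  \<open>l\<close> are strict so that they carry over to \<open>L n\<close> and \<open>A n\<close>
  for large n.\<close>

lemma indep_ratio_ge:
  assumes "b > 0" "k > 0" "c > 0" "d > 0" "b * real k < 1"
    and l: "l = ln ((1 - b * real k) / b)" and L0: "\<And>L. L \<ge> L0 \<Longrightarrow> sparse d L" "l > L0"
    and gap: "b * c / 2 < l + 1 - gap d l"
  shows "b - sqrt (4 / real k * (b * (b * c / 2) * exp (4 - 2 * l))) \<le> indep_ratio c"
proof -
  define s where "s = (\<lambda>n. nat \<lceil>b * real n\<rceil>)"
  define L where "L = (\<lambda>n. ln (real (n div k - s n) * real k / real (s n)))"
  define A where "A = (\<lambda>n. real (s n) * (- ln (1 - c / real n)) / 2)"
  define N where "N = (\<lambda>n. real (n div k))"
  have s: "(\<lambda>n. real (s n) / real n) \<longlonglongrightarrow> b"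
    unfolding s_def by (rule tendsto_ceiling_ratio[OF assms(1)])
  have N: "(\<lambda>n. N n / real n) \<longlonglongrightarrow> 1 / real k"
    unfolding N_def by (rule tendsto_div_nat[OF assms(2)])
  have bk: "b < 1 / real k" using assms(2,5) by (simp add: less_divide_eq)
  have ev_s: "\<forall>\<^sub>F n in sequentially. s n > 0"
    using order_tendstoD(1)[OF s assms(1)]
    by eventually_elim (auto intro!: gr0I)
  have ev_sN: "\<forall>\<^sub>F n in sequentially. s n < n div k"
  proof -
    have "(\<lambda>n. N n / real n - real (s n) / real n) \<longlonglongrightarrow> 1 / real k - b"
      by (intro tendsto_diff N s)
    then have "\<forall>\<^sub>F n in sequentially. 0 < N n / real n - real (s n) / real n"
      using bk by (intro order_tendstoD(1)) auto
    then show ?thesis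
      using eventually_gt_at_top[of 0]
      by eventually_elim (simp add: N_def diff_divide_distrib[symmetric] zero_less_divide_iff)
  qed
  have Lim_L: "L \<longlonglongrightarrow> l"
  proof -
    have lim: "(\<lambda>n. ln ((N n / real n - real (s n) / real n) * real k / (real (s n) / real n))) \<longlonglongrightarrow> ln ((1 / real k - b) * real k / b)"
      by (intro tendsto_intros N s) (use assms(1,2) bk in auto)
    have eq: "(1 / real k - b) * real k / b = (1 - b * real k) / b"
      using assms(2) by (simp add: left_diff_distrib)
    have "\<forall>\<^sub>F n in sequentially. ln ((N n / real n - real (s n) / real n) * real k / (real (s n) / real n)) = L n"
      using ev_sN eventually_gt_at_top[of 0]
      by eventually_elim (simp add: L_def N_def diff_divide_distrib[symmetric] of_nat_diff less_imp_le)
    from Lim_transform_eventually[OF lim this] show ?thesis unfolding l eq .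
  qed
  have Lim_A: "A \<longlonglongrightarrow> b * c / 2"
  proof -
    have "(\<lambda>n. real n * (- ln (1 - c / real n))) \<longlonglongrightarrow> c" by real_asymp
    then have lim: "(\<lambda>n. real (s n) / real n * (real n * (- ln (1 - c / real n))) / 2) \<longlonglongrightarrow> b * c / 2"
      by (intro tendsto_intros s) auto
    have "\<forall>\<^sub>F n in sequentially. real (s n) / real n * (real n * (- ln (1 - c / real n))) / 2 = A n"
      using eventually_gt_at_top[of 0] by eventually_elim (simp add: A_def)
    from Lim_transform_eventually[OF lim this] show ?thesis .
  qed
  have ev_sparse: "\<forall>\<^sub>F n in sequentially. sparse d (L n)"
    using order_tendstoD(1)[OF Lim_L L0(2)] by eventually_elim (auto intro: L0(1))
  have ev_gap: "\<forall>\<^sub>F n in sequentially. A n \<le> L n + 1 - gap d (L n)"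
  proof -
    have "(\<lambda>n. L n + 1 - gap d (L n) - A n) \<longlonglongrightarrow> l + 1 - gap d l - b * c / 2"
      unfolding gap_def by (intro tendsto_intros Lim_L Lim_A) auto
    then have "\<forall>\<^sub>F n in sequentially. 0 < L n + 1 - gap d (L n) - A n"
      using gap by (intro order_tendstoD(1)) auto
    then show ?thesis by eventually_elim simp
  qed
  define R where "R = (\<lambda>n. 4 * (N n / real n + 1 / real n) *
     (real (s n) / real n * A n * exp (4 - 2 * L n) + (2 * ln (real n + 1) + ln 3) / real n))"
  have "\<forall>\<^sub>F n in sequentially. real (s n) / real n - sqrt (R n) \<le> mean_alpha {..<n} (c / n) / real n"
    using ev_s ev_sN ev_sparse ev_gap eventually_gt_at_top[of "nat \<lceil>c\<rceil>"]
  proof eventually_elim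
    case (elim n)
    have n: "c < real n" "real n > 0" using elim(5) assms(3) by linarith+
    let ?Q = "4 * (real (n div k) + 1) * (real (s n) * A n * exp (4 - 2 * L n) + 2 * ln (real n + 1) + ln 3)"
    have "real (s n) - sqrt ?Q \<le> mean_alpha {..<n} (c / real n)"
      by (rule mean_alpha_lower[OF assms(2) elim(1,2) _ _ assms(4) _ _ elim(3,4)])
        (use n assms(3) in \<open>auto simp: L_def A_def\<close>)
    then have "(real (s n) - sqrt ?Q) / real n \<le> mean_alpha {..<n} (c / real n) / real n"
      by (intro divide_right_mono) auto
    moreover have "sqrt ?Q / real n = sqrt (R n)"
    proof -
      have "sqrt ?Q / real n = sqrt (?Q / (real n)\<^sup>2)" using n by (simp add: real_sqrt_divide)
      also have "?Q / (real n)\<^sup>2 = R n"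
        using n by (simp add: R_def N_def power2_eq_square add_divide_distrib algebra_simps)
      finally show ?thesis .
    qed
    ultimately show ?case by (simp add: diff_divide_distrib)
  qed
  moreover have "R \<longlonglongrightarrow> 4 * (1 / real k + 0) * (b * (b * c / 2) * exp (4 - 2 * l) + 0)"
  proof -
    have "(\<lambda>n. 1 / real n) \<longlonglongrightarrow> 0" "(\<lambda>n. (2 * ln (real n + 1) + ln 3) / real n) \<longlonglongrightarrow> 0"
      by real_asymp+
    then show ?thesis
      unfolding R_def by (intro tendsto_intros N s Lim_A Lim_L)
  qed
  then have "(\<lambda>n. real (s n) / real n - sqrt (R n)) \<longlonglongrightarrow>
     b - sqrt (4 * (1 / real k + 0) * (b * (b * c / 2) * exp (4 - 2 * l) + 0))"
    by (intro tendsto_intros s)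
  ultimately show ?thesis
    using tendsto_le[OF sequentially_bot mean_alpha_tendsto[OF assms(3)]] by simp
qed

section \<open>Choice of the parameters for small density\<close>

lemma gap_antimono: "d > 0 \<Longrightarrow> L \<le> L' \<Longrightarrow> gap d L' \<le> gap d L"
  unfolding gap_def by (intro mult_left_mono) auto

theorem theorem1:
  fixes x :: real
  assumes "x > 4 / exp 1"
  shows "\<exists>\<alpha>\<^sub>0>0. \<forall>\<alpha>. 0 < \<alpha> \<and> \<alpha> < \<alpha>\<^sub>0 \<longrightarrow>
           c_crit \<alpha> \<ge> 2 * ((ln (1 / \<alpha>) + 1) / \<alpha>) - x / sqrt \<alpha>"
proof -
  \<comment> \<open>Half of the relative excess of \<open>x\<close> over 4/e goes into
    \<open>gap\<close>; the other half keeps the inequality strict.\<close>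
  define d where "d = (x * exp 1 / 4 - 1) / 2"
  have "x * exp 1 > 4" using assms by (simp add: divide_less_eq)
  then have d: "d > 0" "(1 + d) * (2 * exp (-1)) < x / 2"
    by (simp_all add: d_def exp_minus field_simps)
  obtain L0 where L0: "\<And>L. L \<ge> L0 \<Longrightarrow> sparse d L"
    using eventually_sparse[OF d(1)] by (auto simp: eventually_at_top_linorder)
  define c where "c = (\<lambda>a. 2 * ((ln (1 / a) + 1) / a) - x / sqrt a)"
  \<comment> \<open>The second moment is run at the density \<open>b a\<close>, whose excess over \<open>a\<close> pays for the concentration loss;
    the block size \<open>k\<close> below is at most \<open>2 * a powr (-1/4)\<close>, whence \<open>g\<close> and \<open>l\<close>.\<close>
  define b where "b = (\<lambda>a::real. a + a powr (8/5))"
  define g where "g = (\<lambda>a. 2 * b a * a powr (-1/4))"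
  define l where "l = (\<lambda>a. ln ((1 - g a) / b a))"
  have ev_c: "\<forall>\<^sub>F a in at_right 0. c a > 0"
    unfolding c_def by real_asymp
  have ev_g: "\<forall>\<^sub>F a in at_right 0. g a < 1"
    unfolding g_def b_def by real_asymp
  have ev_l: "\<forall>\<^sub>F a in at_right 0. l a > L0"
    unfolding l_def g_def b_def by real_asymp
  have ev_gap: "\<forall>\<^sub>F a in at_right 0. b a * c a / 2 < l a + 1 - gap d (l a)"
  proof -
    \<comment> \<open>The terms ln (1/a) + 1 cancel. The excess density changes the difference by
      order a^(3/5) ln (1/a), the blocks by order a^(3/4), both of smaller order than sqrt a; so
      only \<open>x\<close> and \<open>gap\<close> are left in the limit.\<close>
    have "((\<lambda>a. (l a + 1 - gap d (l a) - b a * c a / 2) / sqrt a) \<longlongrightarrow> x / 2 - (1 + d) * (2 * exp (-1))) (at_right 0)"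
      unfolding l_def g_def b_def c_def gap_def by real_asymp
    then have "\<forall>\<^sub>F a in at_right 0. 0 < (l a + 1 - gap d (l a) - b a * c a / 2) / sqrt a"
      using d(2) by (intro order_tendstoD(1)) auto
    then show ?thesis
      using eventually_at_right_less[of 0] by eventually_elim (simp add: zero_less_divide_iff)
  qed
  \<comment> \<open>The left side is of order a^(13/4) ln (1/a), and 13/4 exceeds 16/5.\<close>
  have ev_R: "\<forall>\<^sub>F a in at_right 0. 4 * a powr (1/4) * (b a * (b a * c a / 2) * exp (4 - 2 * l a)) \<le> (a powr (8/5))\<^sup>2"
    unfolding l_def g_def b_def c_def by real_asymp
  have "\<forall>\<^sub>F a in at_right (0::real). a < 1"
    by (rule eventually_at_right_real[of 0 1, THEN eventually_mono]) auto
  with ev_c ev_g ev_l ev_gap ev_R eventually_at_right_less[of 0]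
  have "\<forall>\<^sub>F a in at_right 0. c_crit a \<ge> c a"
  proof eventually_elim
    case (elim a)
    define k where "k = nat \<lceil>a powr (-1/4)\<rceil>"
    have "a powr (-1/4) \<ge> a powr 0"
      using elim by (intro powr_mono') auto
    then have pk: "a powr (-1/4) \<ge> 1" using elim by simp
    then have k: "k > 0" "real k \<ge> a powr (-1/4)" "real k \<le> 2 * a powr (-1/4)"
      unfolding k_def by linarith+
    have b: "b a > 0" using elim by (simp add: b_def add_pos_nonneg)
    have bk: "b a * real k \<le> g a"
      using mult_left_mono[OF k(3), of "b a"] b by (simp add: g_def)
    \<comment> \<open>The limit exponent for the integer block size. As \<open>g a\<close>
      overestimates \<open>b a * real k\<close>, it is at least \<open>l a\<close>;
      \<open>gap\<close> and the concentration loss decrease in it, so all conditions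
      transfer.\<close>
    define l' where "l' = ln ((1 - b a * real k) / b a)"
    have l': "l a \<le> l'"
      unfolding l_def l'_def using bk b elim by (simp add: divide_right_mono)
    have gap': "gap d l' \<le> gap d (l a)" by (rule gap_antimono[OF d(1) l'])
    let ?R = "4 / real k * (b a * (b a * c a / 2) * exp (4 - 2 * l'))"
    have "b a - sqrt ?R \<le> indep_ratio (c a)"
      by (rule indep_ratio_ge[OF b k(1) _ d(1) _ l'_def L0]) (use elim bk l' gap' in auto)
    moreover have "sqrt ?R \<le> a powr (8/5)"
    proof (rule real_le_lsqrt)
      have "1 / real k \<le> 1 / a powr (-1/4)"
        by (rule frac_le) (use pk k in auto)
      also have "\<dots> = a powr (1/4)" by (simp add: powr_minus_divide)
      finally have "4 / real k \<le> 4 * a powr (1/4)" by simp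
      then have "?R \<le> 4 * a powr (1/4) * (b a * (b a * c a / 2) * exp (4 - 2 * l a))"
        using b elim l' by (intro mult_mono) auto
      then show "?R \<le> (a powr (8/5))\<^sup>2" using elim by linarith
    qed simp
    ultimately have "a \<le> indep_ratio (c a)" by (simp add: b_def)
    then show ?case using elim by (intro c_crit_ge) auto
  qed
  then obtain a0 where "a0 > 0" "\<And>a. 0 < a \<Longrightarrow> a < a0 \<Longrightarrow> c_crit a \<ge> c a"
    unfolding eventually_at_right_field by auto
  then show ?thesis unfolding c_def by blast
qed

end
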